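(* Let $\alpha,\beta>0$, $T_{\mathrm m}\in\mathbb R$, $\varepsilon_1>-1$, $\varepsilon_2>-1$. Consider the closed-loop system $$T_t(x,t)=\alpha(1+\varepsilon_1)T_{xx}(x,t)\ (0\le x\le s(t)),\quad T(0,t)=T_{\mathrm m}+T_{\mathrm c}(t),\quad T(s(t),t)=T_{\mathrm m},\quad \dot s(t)=-\beta(1+\varepsilon_2)T_x(s(t),t),$$ with $T(x,0)=T_0(x)$, $s(0)=s_0$, and the control law (built with the nominal parameters $\alpha,\beta$) $$T_{\mathrm c}(t)=-c\left(\frac1\alpha\int_0^{s(t)}x\,(T(x,t)-T_{\mathrm m})\,dx+\frac1\beta s(t)(s(t)-s_{\mathrm r})\right).$$ Assume $s_0>0$, that for some constant $H$ one has $0\le T_0(x)-T_{\mathrm m}\le H(s_0-x)$ on $[0,s_0]$, and that the setpoint satisfies $$s_{\mathrm r}>\sqrt{s_0^2+\frac{2\beta}{\alpha}\int_0^{s_0}x\,(T_0(x)-T_{\mathrm m})\,dx}\,.$$ Then, for any perturbations $(\varepsilon_1,\varepsilon_2)$ with $\varepsilon_1\ge\varepsilon_2$, there exists $c^*>0$ such that for every $c$ with $0<c<c^*$ the closed-loop system is exponentially stable in the sense of the norm $$\|T-T_{\mathrm m}\|_{\mathcal H_1}^2+(s(t)-s_{\mathrm r})^2 .$$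
   Context: The unknowns are the liquid temperature $T(x,t)$, $0\le x\le s(t)$, and the moving interface $s(t)>0$; $(T,s)$ denotes the (classical) solution of the closed-loop system for $t\ge0$. $T_{\mathrm m}$ is the melting temperature, $s_{\mathrm r}$ is the desired setpoint for the interface, $c$ is the controller gain, and $T_{\mathrm c}(t)$ is the controlled boundary temperature measured relative to $T_{\mathrm m}$. Norms at time $t$: $\|u\|_{\mathcal L_2}^2=\int_0^{s(t)}u(x,t)^2dx$ and $\|u\|_{\mathcal H_1}^2=\|u\|_{\mathcal L_2}^2+\|u_x\|_{\mathcal L_2}^2$. "Exponentially stable in the sense of the norm $\Phi(t)$" means: there exist constants $D,b>0$, depending only on the system parameters (including $\varepsilon_1,\varepsilon_2$), the gain and the setpoint (not on the particular solution), such that $\Phi(t)\le D\,\Phi(0)e^{-bt}$ for all $t\ge0$. *)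

theory Defs
  imports "HOL-Analysis.Analysis"
begin

definition L2_sq :: "real \<Rightarrow> (real \<Rightarrow> real) \<Rightarrow> real" where
  "L2_sq l u = integral {0..l} (\<lambda>x. (u x)\<^sup>2)"

text \<open>The two-sided derivative is used here; the end points of the interval, where it depends
  on values of \<open>u\<close> outside the interval, form a null set and do not affect the integral.\<close>

definition H1_sq :: "real \<Rightarrow> (real \<Rightarrow> real) \<Rightarrow> real" where
  "H1_sq l u = L2_sq l u + L2_sq l (deriv u)"

text \<open>A temperature field is a function \<open>T x t\<close>; only its values for \<open>0 \<le> x \<le> s t\<close>,
  \<open>0 \<le> t\<close> are meaningful.\<close>

definition control ::
  "real \<Rightarrow> real \<Rightarrow> real \<Rightarrow> real \<Rightarrow> real \<Rightarrow> (real \<Rightarrow> real \<Rightarrow> real) \<Rightarrow> (real \<Rightarrow> real) \<Rightarrow> real \<Rightarrow> real"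
where
  "control \<alpha> \<beta> Tm c sr T s t =
     - c * (1 / \<alpha> * integral {0..s t} (\<lambda>x. x * (T x t - Tm)) + 1 / \<beta> * s t * (s t - sr))"

definition liquid_domain :: "(real \<Rightarrow> real) \<Rightarrow> (real \<times> real) set" where
  "liquid_domain s = {(x, t). 0 \<le> t \<and> 0 \<le> x \<and> x \<le> s t}"

text \<open>Classical solution, global in time, of the closed loop started from \<open>(T0, s0)\<close>.
  \<open>Tx\<close>, \<open>Txx\<close>, \<open>Tt\<close> are the partial derivatives, with one-sided \<open>x\<close>-derivatives at \<open>x = 0\<close> and
  \<open>x = s t\<close>.  The time derivative is taken in the interior, where it is two-sided, and
  \<open>Tt\<close> is its continuous extension up to the lateral boundary.  \<open>T\<close> and \<open>Tx\<close> are continuous up to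
  \<open>t = 0\<close> (so the \<open>H\<^sup>1\<close> norm is meaningful there), but \<open>Txx\<close> and \<open>Tt\<close> need only exist for
  \<open>t > 0\<close>.  The plant has the perturbed coefficients, the control law the nominal ones.\<close>

definition closed_loop_solution ::
  "real \<Rightarrow> real \<Rightarrow> real \<Rightarrow> real \<Rightarrow> real \<Rightarrow> real \<Rightarrow> real \<Rightarrow> (real \<Rightarrow> real) \<Rightarrow> real \<Rightarrow>
   (real \<Rightarrow> real \<Rightarrow> real) \<Rightarrow> (real \<Rightarrow> real) \<Rightarrow> bool"
where
  "closed_loop_solution \<alpha> \<beta> Tm \<epsilon>1 \<epsilon>2 c sr T0 s0 T s \<longleftrightarrow>
     (\<forall>t\<ge>0. s t > 0) \<and>
     (\<exists>Tx Txx Tt :: real \<Rightarrow> real \<Rightarrow> real.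
        continuous_on (liquid_domain s) (\<lambda>(x, t). T x t) \<and>
        continuous_on (liquid_domain s) (\<lambda>(x, t). Tx x t) \<and>
        continuous_on (liquid_domain s \<inter> {(x, t). t > 0}) (\<lambda>(x, t). Txx x t) \<and>
        continuous_on (liquid_domain s \<inter> {(x, t). t > 0}) (\<lambda>(x, t). Tt x t) \<and>
        (\<forall>t\<ge>0. \<forall>x\<in>{0..s t}.
           ((\<lambda>y. T y t) has_real_derivative Tx x t) (at x within {0..s t})) \<and>
        (\<forall>t>0. \<forall>x\<in>{0..s t}.
           ((\<lambda>y. Tx y t) has_real_derivative Txx x t) (at x within {0..s t})) \<and>
        (\<forall>t>0. \<forall>x\<in>{0<..<s t}. ((\<lambda>\<tau>. T x \<tau>) has_real_derivative Tt x t) (at t)) \<and>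
        (\<forall>t>0. \<forall>x\<in>{0..s t}. Tt x t = \<alpha> * (1 + \<epsilon>1) * Txx x t) \<and>
        (\<forall>t\<ge>0. (s has_real_derivative - \<beta> * (1 + \<epsilon>2) * Tx (s t) t) (at t within {0..}))) \<and>
     (\<forall>t\<ge>0. T 0 t = Tm + control \<alpha> \<beta> Tm c sr T s t) \<and>
     (\<forall>t\<ge>0. T (s t) t = Tm) \<and>
     (\<forall>x\<in>{0..s0}. T x 0 = T0 x) \<and>
     s 0 = s0"

definition stability_norm ::
  "real \<Rightarrow> real \<Rightarrow> (real \<Rightarrow> real \<Rightarrow> real) \<Rightarrow> (real \<Rightarrow> real) \<Rightarrow> real \<Rightarrow> real"
where
  "stability_norm Tm sr T s t = H1_sq (s t) (\<lambda>x. T x t - Tm) + (s t - sr)\<^sup>2"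

text \<open>A pair \<open>(T0, s0)\<close> satisfying the standing assumptions, including the setpoint restriction.\<close>

definition admissible_data ::
  "real \<Rightarrow> real \<Rightarrow> real \<Rightarrow> real \<Rightarrow> (real \<Rightarrow> real) \<Rightarrow> real \<Rightarrow> bool"
where
  "admissible_data \<alpha> \<beta> Tm sr T0 s0 \<longleftrightarrow>
     s0 > 0 \<and>
     (\<exists>H. \<forall>x\<in>{0..s0}. 0 \<le> T0 x - Tm \<and> T0 x - Tm \<le> H * (s0 - x)) \<and>
     sr > sqrt (s0\<^sup>2 + 2 * \<beta> / \<alpha> * integral {0..s0} (\<lambda>x. x * (T0 x - Tm)))"

text \<open>The constants \<open>D\<close> and \<open>b\<close> are uniform over all admissible initial data and all solutions.\<close>

definition closed_loop_exp_stable ::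
  "real \<Rightarrow> real \<Rightarrow> real \<Rightarrow> real \<Rightarrow> real \<Rightarrow> real \<Rightarrow> real \<Rightarrow> bool"
where
  "closed_loop_exp_stable \<alpha> \<beta> Tm \<epsilon>1 \<epsilon>2 c sr \<longleftrightarrow>
     (\<exists>D>0. \<exists>b>0. \<forall>T0 s0 T s.
        admissible_data \<alpha> \<beta> Tm sr T0 s0 \<longrightarrow>
        closed_loop_solution \<alpha> \<beta> Tm \<epsilon>1 \<epsilon>2 c sr T0 s0 T s \<longrightarrow>
        (\<forall>t\<ge>0. stability_norm Tm sr T s t \<le> D * stability_norm Tm sr T s 0 * exp (- b * t)))"

end

theory Submission
  imports Defs
begin

text \<open>Put \<open>u = T - Tm\<close>, \<open>\<kappa> = \<alpha> (1 + \<epsilon>1)\<close>, \<open>\<nu> = \<beta> (1 + \<epsilon>2)\<close> and freeze the domain by \<open>y = x / s\<close>.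

  Signs.  The boundary value satisfies \<open>u(0)' = - c (1 + \<epsilon>1) u(0) - c u\<^sub>x(s) B\<close> with
  \<open>B = (\<epsilon>1 - \<epsilon>2) s + (1 + \<epsilon>2) (sr - s)\<close>.  The setpoint restriction says that
  \<open>R = (sr\<^sup>2 - s\<^sup>2) / (2 \<beta>) - (1 / \<alpha>) \<integral> x u\<close> is initially positive; since \<open>R' \<ge> - c (1 + \<epsilon>1) R\<close> as
  long as \<open>u \<ge> 0\<close>, this keeps \<open>s < sr\<close> and \<open>B \<ge> 0\<close>, and a continuation argument with the minimum
  principle gives \<open>u \<ge> 0\<close>, \<open>u\<^sub>x(s) \<le> 0\<close> and \<open>s' \<ge> 0\<close> for all time.  (When \<open>u(0) = 0\<close> initially, the
  minimum principle alone does not start the argument; a barrier controlled by the negative part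
  of \<open>u(0)\<close> does.)

  Decay.  With \<open>G = \<integral> x (2 sr - x) u\<close>, the functional
  \<open>L = (sr\<^sup>2 - s\<^sup>2) / (2 \<nu>) - (1 / \<kappa>) \<integral> x u + G / (4 \<kappa> sr)\<close> is equivalent to \<open>sr - s\<close> and satisfies
  \<open>L' \<le> - k s L\<close> when \<open>6 c sr\<^sup>2 \<le> \<alpha>\<close>.  The degeneracy for small \<open>s\<close> is harmless because \<open>s\<close> exceeds
  \<open>sr / 2\<close> after a time that does not depend on the data: the functional
  \<open>Y = (1 / \<kappa>) \<integral> x u + s\<^sup>2 / (2 \<nu>) + c / (6 \<kappa> \<alpha>) \<integral> x\<^sup>3 u + c s\<^sup>4 / (24 \<alpha> \<nu>)\<close> has
  \<open>Y' = (c / \<beta>) s (sr - s)\<close> exactly, and \<open>Y\<close> is of order \<open>s\<^sup>2\<close> after an initial layer.  Finally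
  \<open>N = \<integral> u\<^sub>x\<^sup>2\<close> satisfies \<open>N' \<le> - \<eta> N + C L\<^sup>2\<close>, because \<open>u\<^sub>x\<close> at both ends is controlled by \<open>u(0)\<close>
  and \<open>u\<^sub>x\<^sub>x\<close>.\<close>

section \<open>Comparison for scalar differential inequalities\<close>

text \<open>The derivative enters existentially together with its bound because the functionals
  below are fed in through one-sided bounds on their derivatives. Only interior times are used,
  since \<open>Ut\<close> and \<open>Uyy\<close> are available for positive times only.\<close>

lemma deriv_bound_imp_bound:
  fixes f :: "real \<Rightarrow> real"
  assumes "a \<le> b" and cont: "continuous_on {a..b} f"
    and der: "\<And>t. a < t \<Longrightarrow> t < b \<Longrightarrow> \<exists>d. (f has_real_derivative d) (at t) \<and> d \<le> m"
  shows "f b \<le> f a + m * (b - a)"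
proof (cases "a < b")
  case True
  have "\<exists>l z. a < z \<and> z < b \<and> DERIV f z :> l \<and> f b - f a = (b - a) * l"
    by (rule MVT[OF True cont]) (use der real_differentiable_def in blast)
  then obtain l z where z: "a < z" "z < b" "DERIV f z :> l" "f b - f a = (b - a) * l" by blast
  with der[OF z(1,2)] have "l \<le> m" using DERIV_unique by blast
  then have "(b - a) * l \<le> (b - a) * m" using True by (intro mult_left_mono) auto
  then show ?thesis using z by (simp add: algebra_simps)
qed (use assms in auto)

text \<open>The integrating factor \<open>exp (- k * t)\<close> turns the hypothesis into
  monotonicity of \<open>f t * exp (- k * t)\<close>; \<open>f\<close> and \<open>k\<close> may have
  any sign.\<close>

lemma gronwall_le:
  fixes f :: "real \<Rightarrow> real"
  assumes "a \<le> b" and cont: "continuous_on {a..b} f"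
    and der: "\<And>t. a < t \<Longrightarrow> t < b \<Longrightarrow> \<exists>d. (f has_real_derivative d) (at t) \<and> d \<le> k * f t"
  shows "f b \<le> f a * exp (k * (b - a))"
proof -
  let ?g = "\<lambda>t. f t * exp (- k * t)"
  have "?g b \<le> ?g a + 0 * (b - a)"
  proof (rule deriv_bound_imp_bound[OF \<open>a \<le> b\<close>])
    show "continuous_on {a..b} ?g" by (intro continuous_intros cont)
    fix t assume t: "a < t" "t < b"
    from der[OF t] obtain d where d: "(f has_real_derivative d) (at t)" "d \<le> k * f t" by blast
    have "(?g has_real_derivative d * exp (- k * t) + f t * (exp (- k * t) * (- k))) (at t)"
      by (auto intro!: derivative_eq_intros d(1))
    moreover have "d * exp (- k * t) + f t * (exp (- k * t) * (- k)) = (d - k * f t) * exp (- k * t)"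
      by (simp add: algebra_simps)
    moreover have "(d - k * f t) * exp (- k * t) \<le> 0"
      using d(2) by (intro mult_nonpos_nonneg) auto
    ultimately show "\<exists>d. (?g has_real_derivative d) (at t) \<and> d \<le> 0" by metis
  qed
  then have "f b * exp (- k * b) * exp (k * b) \<le> f a * exp (- k * a) * exp (k * b)"
    by (intro mult_right_mono) auto
  then show ?thesis
    by (simp add: mult.assoc flip: exp_add) (simp add: algebra_simps)
qed

lemma gronwall_ge:
  fixes f :: "real \<Rightarrow> real"
  assumes "a \<le> b" and cont: "continuous_on {a..b} f"
    and der: "\<And>t. a < t \<Longrightarrow> t < b \<Longrightarrow> \<exists>d. (f has_real_derivative d) (at t) \<and> k * f t \<le> d"
  shows "f a * exp (k * (b - a)) \<le> f b"
proof -
  have "- f b \<le> - f a * exp (k * (b - a))"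
  proof (rule gronwall_le[OF \<open>a \<le> b\<close>])
    show "continuous_on {a..b} (\<lambda>t. - f t)" by (intro continuous_intros cont)
    fix t assume t: "a < t" "t < b"
    from der[OF t] obtain d where d: "(f has_real_derivative d) (at t)" "k * f t \<le> d" by blast
    then show "\<exists>d. ((\<lambda>t. - f t) has_real_derivative d) (at t) \<and> d \<le> k * (- f t)"
      by (intro exI[of _ "- d"]) (auto intro!: derivative_eq_intros)
  qed
  then show ?thesis by simp
qed

section \<open>Integral inequalities on the unit interval\<close>

text \<open>Expand the nonnegative integral of the square of \<open>f x - m\<close>, with
  \<open>m\<close> the integral of \<open>f\<close>; since the length is at most \<open>1\<close>,
  the constant term is at most \<open>m\<^sup>2\<close>.\<close>

lemma square_integral_le_integral_square:
  fixes f :: "real \<Rightarrow> real"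
  assumes cont: "continuous_on {a..b} f" and ab: "a \<le> b" "b - a \<le> 1"
  shows "(integral {a..b} f)\<^sup>2 \<le> integral {a..b} (\<lambda>x. (f x)\<^sup>2)"
proof -
  define m where "m = integral {a..b} f"
  have int: "f integrable_on {a..b}" "(\<lambda>x. (f x)\<^sup>2) integrable_on {a..b}"
    by (auto intro!: integrable_continuous_interval continuous_intros cont)
  have "(f has_integral m) {a..b}" "((\<lambda>x. (f x)\<^sup>2) has_integral integral {a..b} (\<lambda>x. (f x)\<^sup>2)) {a..b}"
    using int m_def by (auto simp: has_integral_integrable_integral)
  moreover have "((\<lambda>x. m\<^sup>2) has_integral (b - a) * m\<^sup>2) {a..b}"
    using has_integral_const_real[of "m\<^sup>2" a b] ab by simp
  ultimately have "((\<lambda>x. (f x)\<^sup>2 - 2 * m * f x + m\<^sup>2) has_integral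
      integral {a..b} (\<lambda>x. (f x)\<^sup>2) - 2 * m * m + (b - a) * m\<^sup>2) {a..b}"
    by (intro has_integral_add has_integral_diff has_integral_mult_right)
  then have "0 \<le> integral {a..b} (\<lambda>x. (f x)\<^sup>2) - 2 * m * m + (b - a) * m\<^sup>2"
  proof (rule has_integral_nonneg)
    fix x show "0 \<le> (f x)\<^sup>2 - 2 * m * f x + m\<^sup>2"
      using zero_le_power2[of "f x - m"] by (simp add: power2_diff mult.commute algebra_simps)
  qed
  moreover have "(b - a) * m\<^sup>2 \<le> 1 * m\<^sup>2" using ab by (intro mult_right_mono) auto
  ultimately show ?thesis unfolding m_def[symmetric] by (simp add: power2_eq_square)
qed

text \<open>Fundamental theorem plus the previous inequality on the segment between the points. For
  \<open>U\<close>, which vanishes at \<open>1\<close>, this is a Poincare inequality; for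
  \<open>Uy\<close> it bounds the oscillation by \<open>Uyy\<close>.\<close>

lemma square_increment_le:
  fixes F f :: "real \<Rightarrow> real"
  assumes der: "\<And>y. y \<in> {0..1} \<Longrightarrow> (F has_real_derivative f y) (at y within {0..1})"
    and cont: "continuous_on {0..1} f" and xy: "x \<in> {0..1}" "y \<in> {0..1}"
  shows "(F y - F x)\<^sup>2 \<le> integral {0..1} (\<lambda>z. (f z)\<^sup>2)"
  using xy
proof (induction x y rule: linorder_wlog)
  case (sym a b) then show ?case by (simp add: power2_commute)
next
  case (le x y)
  then have sub: "{x..y} \<subseteq> {0..1}" by auto
  have ftc: "(f has_integral F y - F x) {x..y}"
    by (rule fundamental_theorem_of_calculus[OF \<open>x \<le> y\<close>])
      (use der sub in \<open>auto intro!: DERIV_subset[OF der sub]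
         simp flip: has_real_derivative_iff_has_vector_derivative\<close>)
  have c: "continuous_on {x..y} f" using cont sub by (rule continuous_on_subset)
  have "(F y - F x)\<^sup>2 = (integral {x..y} f)\<^sup>2" using ftc by (simp add: integral_unique)
  also have "\<dots> \<le> integral {x..y} (\<lambda>z. (f z)\<^sup>2)"
    by (rule square_integral_le_integral_square[OF c]) (use le in auto)
  also have "\<dots> \<le> integral {0..1} (\<lambda>z. (f z)\<^sup>2)"
    by (rule integral_subset_le[OF sub])
      (auto intro!: integrable_continuous_interval continuous_intros c cont)
  finally show ?case .
qed

section \<open>Parabolic minimum principle\<close>

text \<open>If \<open>g''\<close> were negative, \<open>g'\<close> would become negative just to the
  right of its zero \<open>y\<close>, and the mean value theorem would put \<open>g\<close> below
  its minimum there.\<close>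

lemma second_derivative_nonneg_at_min:
  fixes g g' :: "real \<Rightarrow> real"
  assumes y: "a < y" "y < b"
    and g: "\<And>z. a < z \<Longrightarrow> z < b \<Longrightarrow> (g has_real_derivative g' z) (at z)"
    and g': "(g' has_real_derivative g'') (at y)"
    and min: "\<And>z. a < z \<Longrightarrow> z < b \<Longrightarrow> g y \<le> g z"
  shows "g' y = 0" "0 \<le> g''"
proof -
  have "0 < min (y - a) (b - y)" using y by auto
  then show 0: "g' y = 0"
    by (rule DERIV_local_min[OF g[OF y]]) (use min y in \<open>auto simp: abs_if split: if_splits\<close>)
  show "0 \<le> g''"
  proof (rule ccontr)
    assume "\<not> 0 \<le> g''"
    then obtain d where d: "d > 0" "\<And>h. 0 < h \<Longrightarrow> h < d \<Longrightarrow> g' (y + h) < 0"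
      using DERIV_neg_dec_right[OF g'] 0 by auto
    define h where "h = min d (b - y) / 2"
    have h: "0 < h" "h < d" "y + h < b" using d y by (auto simp: h_def min_def field_simps)
    have "\<And>x. y \<le> x \<Longrightarrow> x \<le> y + h \<Longrightarrow> DERIV g x :> g' x"
      using g y h by auto
    then have "\<exists>z>y. z < y + h \<and> g (y + h) - g y = (y + h - y) * g' z"
      by (intro MVT2) (use h in auto)
    then obtain z where z: "y < z" "z < y + h" "g (y + h) - g y = h * g' z" by auto
    have "g' z < 0" using d(2)[of "z - y"] z h by auto
    then have "h * g' z < 0" using h by (simp add: mult_pos_neg)
    then have "g (y + h) < g y" using z(3) by linarith
    with min[of "y + h"] h y show False by auto
  qed
qed

text \<open>Adding \<open>\<epsilon> * (1 + \<tau> - t0)\<close> makes the supersolution strict. At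
  a minimum of \<open>W\<close> off the parabolic boundary, looking back in time gives
  \<open>Vt + \<epsilon> \<le> 0\<close>, while \<open>Vy = 0\<close> and \<open>Vyy \<ge> 0\<close>
  give \<open>Vt \<ge> 0\<close>. So the minimum lies where the data are nonnegative.\<close>

lemma parabolic_min_principle:
  fixes V Vt Vy Vyy D e :: "real \<Rightarrow> real \<Rightarrow> real"
  assumes cont: "continuous_on ({t0..t1} \<times> {0..1}) (\<lambda>(t, y). V t y)"
    and Vt: "\<And>t y. t0 < t \<Longrightarrow> t \<le> t1 \<Longrightarrow> 0 < y \<Longrightarrow> y < 1 \<Longrightarrow> ((\<lambda>\<tau>. V \<tau> y) has_real_derivative Vt t y) (at t)"
    and Vy: "\<And>t y. t0 < t \<Longrightarrow> t \<le> t1 \<Longrightarrow> 0 < y \<Longrightarrow> y < 1 \<Longrightarrow> (V t has_real_derivative Vy t y) (at y)"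
    and Vyy: "\<And>t y. t0 < t \<Longrightarrow> t \<le> t1 \<Longrightarrow> 0 < y \<Longrightarrow> y < 1 \<Longrightarrow> (Vy t has_real_derivative Vyy t y) (at y)"
    and super: "\<And>t y. t0 < t \<Longrightarrow> t \<le> t1 \<Longrightarrow> 0 < y \<Longrightarrow> y < 1 \<Longrightarrow> Vt t y \<ge> D t y * Vyy t y + e t y * Vy t y"
    and D: "\<And>t y. t0 < t \<Longrightarrow> t \<le> t1 \<Longrightarrow> 0 < y \<Longrightarrow> y < 1 \<Longrightarrow> D t y \<ge> 0"
    and init: "\<And>y. y \<in> {0..1} \<Longrightarrow> V t0 y \<ge> 0"
    and left: "\<And>t. t \<in> {t0..t1} \<Longrightarrow> V t 0 \<ge> 0"
    and right: "\<And>t. t \<in> {t0..t1} \<Longrightarrow> V t 1 \<ge> 0"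
    and ty: "t \<in> {t0..t1}" "y \<in> {0..1}"
  shows "V t y \<ge> 0"
proof (rule field_le_epsilon)
  fix \<delta> :: real assume "\<delta> > 0"
  \<comment> \<open>Scaled so that the added term never exceeds \<open>\<delta>\<close> on the time
    interval.\<close>
  define \<epsilon> where "\<epsilon> = \<delta> / (1 + t1 - t0)"
  have len: "1 + t1 - t0 > 0" using ty by auto
  then have \<epsilon>: "\<epsilon> > 0" "\<epsilon> * (1 + t1 - t0) = \<delta>" using \<open>\<delta> > 0\<close> by (auto simp: \<epsilon>_def)
  define W where "W \<tau> z = V \<tau> z + \<epsilon> * (1 + \<tau> - t0)" for \<tau> z
  have contW: "continuous_on ({t0..t1} \<times> {0..1}) (\<lambda>(t, y). W t y)"
    using cont unfolding W_def by (auto simp: case_prod_unfold intro!: continuous_intros)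
  have ne: "{t0..t1} \<times> {0..1::real} \<noteq> {}" using ty by auto
  have "compact ({t0..t1} \<times> {0..1::real})" by (intro compact_Times) auto
  from continuous_attains_inf[OF this ne contW]
  obtain m where m: "m \<in> {t0..t1} \<times> {0..1}"
     "\<And>q. q \<in> {t0..t1} \<times> {0..1} \<Longrightarrow> (\<lambda>(t, y). W t y) m \<le> (\<lambda>(t, y). W t y) q" by blast
  obtain tm ym where [simp]: "m = (tm, ym)" by (cases m)
  have tm: "tm \<in> {t0..t1}" "ym \<in> {0..1}" using m(1) by auto
  have min: "W tm ym \<le> W \<tau> z" if "\<tau> \<in> {t0..t1}" "z \<in> {0..1}" for \<tau> z
    using m(2)[of "(\<tau>, z)"] that by simp
  have pos: "\<epsilon> * (1 + tm - t0) > 0" using tm \<epsilon>(1) by (intro mult_pos_pos) auto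
  have "W tm ym \<ge> 0"
  proof (cases "tm = t0 \<or> ym = 0 \<or> ym = 1")
    case True
    then show ?thesis unfolding W_def using pos init[of ym] left[of tm] right[of tm] tm by auto
  next
    case False
    then have in_dom: "t0 < tm" "tm \<le> t1" "0 < ym" "ym < 1" using tm by auto
    have dt: "((\<lambda>\<tau>. W \<tau> ym) has_real_derivative Vt tm ym + \<epsilon>) (at tm)"
      unfolding W_def using Vt[OF in_dom] by (auto intro!: derivative_eq_intros)
    have le0: "Vt tm ym + \<epsilon> \<le> 0"
    proof (rule ccontr)
      assume "\<not> Vt tm ym + \<epsilon> \<le> 0"
      then obtain d where d: "d > 0" "\<And>h. 0 < h \<Longrightarrow> h < d \<Longrightarrow> W (tm - h) ym < W tm ym"
        using DERIV_pos_inc_left[OF dt] by auto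
      define h where "h = min d (tm - t0) / 2"
      have h: "0 < h" "h < d" "t0 \<le> tm - h" using d in_dom by (auto simp: h_def min_def field_simps)
      show False using d(2)[OF h(1,2)] min[of "tm - h" ym] h in_dom by auto
    qed
    have dy: "(W tm has_real_derivative Vy tm z) (at z)" if "0 < z" "z < 1" for z
      unfolding W_def[abs_def] using Vy[OF in_dom(1,2) that] by (auto intro!: derivative_eq_intros)
    note extr = second_derivative_nonneg_at_min[OF in_dom(3,4) dy Vyy[OF in_dom]]
    have "Vy tm ym = 0" "0 \<le> Vyy tm ym"
      by (rule extr; use min in_dom in auto)+
    with super[OF in_dom] mult_nonneg_nonneg[OF D[OF in_dom], of "Vyy tm ym"]
    have "Vt tm ym \<ge> 0" by simp
    then show ?thesis using le0 \<epsilon> by auto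
  qed
  then have "0 \<le> W t y" using min[OF ty] by linarith
  moreover have "\<epsilon> * (1 + t - t0) \<le> \<delta>"
    unfolding \<epsilon>(2)[symmetric] using ty \<epsilon>(1) by (intro mult_left_mono) auto
  ultimately show "0 \<le> V t y + \<delta>" unfolding W_def by linarith
qed

section \<open>Time derivatives of integrals and of boundary traces\<close>

lemma continuous_on_slice:
  assumes "continuous_on (A \<times> B) (\<lambda>(t, y). f t y)" "t \<in> A"
  shows "continuous_on B (f t)"
proof -
  have "continuous_on B (\<lambda>y. (t, y))" by (rule continuous_on_Pair) (rule continuous_on_const continuous_on_id)+
  from continuous_on_compose2[OF assms(1) this] show ?thesis using assms(2) by auto
qed

lemma continuous_on_slice2:
  assumes "continuous_on (A \<times> B) (\<lambda>(t, y). f t y)" "y \<in> B"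
  shows "continuous_on A (\<lambda>t. f t y)"
proof -
  have "continuous_on A (\<lambda>t. (t, y))" by (rule continuous_on_Pair) (rule continuous_on_const continuous_on_id)+
  from continuous_on_compose2[OF assms(1) this] show ?thesis using assms(2) by auto
qed

lemma continuous_on_integral_param:
  fixes f :: "real \<Rightarrow> real \<Rightarrow> real"
  assumes "continuous_on (A \<times> {a..b}) (\<lambda>(t, y). f t y)"
  shows "continuous_on A (\<lambda>t. integral {a..b} (f t))"
  using integral_continuous_on_param[of A a b f] assms by simp

text \<open>Caratheodory's form of the derivative: \<open>H\<close> is the difference quotient,
  extended continuously to \<open>t\<close>.\<close>

lemma derivative_of_factored_increment:
  fixes f H :: "real \<Rightarrow> real"
  assumes H: "isCont H t" and t: "t > 0" and f: "\<And>\<tau>. \<tau> > 0 \<Longrightarrow> f \<tau> - f t = (\<tau> - t) * H \<tau>"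
  shows "(f has_real_derivative H t) (at t)"
proof -
  have lim: "H \<midarrow>t\<rightarrow> H t" using H by (simp add: isCont_def)
  have "\<forall>\<^sub>F \<tau> in at t. \<tau> > 0"
    using t by (intro order_tendstoD(1)[OF tendsto_ident_at])
  then have "\<forall>\<^sub>F \<tau> in at t. H \<tau> = (f \<tau> - f t) / (\<tau> - t)"
    using eventually_neq_at_within[of t t UNIV]
    by eventually_elim (use f in auto)
  with lim show ?thesis
    unfolding has_field_derivative_iff by (rule Lim_transform_eventually)
qed

text \<open>When \<open>g\<close> is the time derivative of \<open>F\<close>, this is the difference
  quotient of \<open>F\<close> between \<open>t\<close> and \<open>\<tau>\<close>. Parametrising the
  segment over \<open>{0..1}\<close> keeps it defined and continuous at
  \<open>\<tau> = t\<close>.\<close>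

definition time_average :: "(real \<Rightarrow> real \<Rightarrow> real) \<Rightarrow> real \<Rightarrow> real \<Rightarrow> real \<Rightarrow> real" where
  "time_average g t \<tau> y = integral {0..1} (\<lambda>\<theta>. g (t + \<theta> * (\<tau> - t)) y)"

lemma time_average_same: "time_average g t t y = g t y"
  by (simp add: time_average_def)

lemma segment_pos:
  fixes t \<tau> \<theta> :: real
  assumes "t > 0" "\<tau> > 0" "\<theta> \<in> {0..1}"
  shows "t + \<theta> * (\<tau> - t) > 0"
proof -
  have "t + \<theta> * (\<tau> - t) = (1 - \<theta>) * t + \<theta> * \<tau>" by (simp add: algebra_simps)
  also have "\<dots> > 0" using assms
    by (cases "\<theta> = 0") (auto intro!: add_nonneg_pos mult_nonneg_nonneg mult_pos_pos)
  finally show ?thesis .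
qed

lemma continuous_on_time_average:
  assumes g: "continuous_on ({0<..} \<times> {0..1}) (\<lambda>(t, y). g t y)" and t: "t > 0"
  shows "continuous_on ({0<..} \<times> {0..1}) (\<lambda>(\<tau>, y). time_average g t \<tau> y)"
proof -
  have "continuous_on (({0<..} \<times> {0..1}) \<times> {0..1}) (\<lambda>x. (\<lambda>(t, y). g t y) (t + snd x * (fst (fst x) - t), snd (fst x)))"
    by (rule continuous_on_compose2[OF g]) (auto intro!: continuous_intros segment_pos t simp: case_prod_unfold)
  then have "continuous_on (({0<..} \<times> {0..1}) \<times> cbox 0 1) (\<lambda>(x, \<theta>). g (t + \<theta> * (fst x - t)) (snd x))"
    by (simp add: case_prod_unfold)
  from integral_continuous_on_param[OF this] show ?thesis
    by (simp add: time_average_def case_prod_unfold)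
qed

lemma increment_eq_time_average:
  assumes F: "\<And>u. u > 0 \<Longrightarrow> ((\<lambda>\<tau>. F \<tau> y) has_real_derivative g u y) (at u)"
    and t: "t > 0" and \<tau>: "\<tau> > 0"
  shows "F \<tau> y - F t y = (\<tau> - t) * time_average g t \<tau> y"
proof -
  have "((\<lambda>\<theta>. (\<tau> - t) * g (t + \<theta> * (\<tau> - t)) y) has_integral
      F (t + 1 * (\<tau> - t)) y - F (t + 0 * (\<tau> - t)) y) {0..1}"
  proof (rule fundamental_theorem_of_calculus)
    fix \<theta> :: real assume \<theta>: "\<theta> \<in> {0..1}"
    have "((\<lambda>\<theta>. t + \<theta> * (\<tau> - t)) has_real_derivative (\<tau> - t)) (at \<theta>)"
      by (auto intro!: derivative_eq_intros)
    from DERIV_chain2[OF F[OF segment_pos[OF t \<tau> \<theta>]] this]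
    show "((\<lambda>\<theta>. F (t + \<theta> * (\<tau> - t)) y) has_vector_derivative (\<tau> - t) * g (t + \<theta> * (\<tau> - t)) y)
        (at \<theta> within {0..1})"
      unfolding has_real_derivative_iff_has_vector_derivative[symmetric]
      by (simp add: mult.commute has_field_derivative_at_within)
  qed simp
  from integral_unique[OF this] show ?thesis by (simp add: time_average_def)
qed

text \<open>For interior \<open>y\<close> the increment of \<open>F\<close> is
  \<open>\<tau> - t\<close> times the time average of \<open>g\<close>. Both sides are continuous in
  \<open>y\<close> on the closed interval, so the identity reaches the end points, and continuity of
  the average in \<open>\<tau>\<close> yields the derivative there.\<close>

lemma time_derivative_up_to_boundary:
  assumes F: "\<And>t. t > 0 \<Longrightarrow> continuous_on {0..1} (F t)"
    and g: "continuous_on ({0<..} \<times> {0..1}) (\<lambda>(t, y). g t y)"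
    and der: "\<And>t y. t > 0 \<Longrightarrow> 0 < y \<Longrightarrow> y < 1 \<Longrightarrow> ((\<lambda>\<tau>. F \<tau> y) has_real_derivative g t y) (at t)"
    and t: "t > 0" and y: "y \<in> {0..1::real}"
  shows "((\<lambda>\<tau>. F \<tau> y) has_real_derivative g t y) (at t)"
proof -
  note avg = continuous_on_time_average[OF g t]
  have "((\<lambda>\<tau>. F \<tau> y) has_real_derivative time_average g t t y) (at t)"
  proof (rule derivative_of_factored_increment[where f = "\<lambda>\<tau>. F \<tau> y"
        and H = "\<lambda>\<tau>. time_average g t \<tau> y", OF _ t])
    have "continuous_on {0<..} (\<lambda>\<tau>. time_average g t \<tau> y)"
      by (rule continuous_on_slice2[OF avg y])
    then show "isCont (\<lambda>\<tau>. time_average g t \<tau> y) t" using t by (simp add: continuous_on_eq_continuous_at)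
    fix \<tau> :: real assume \<tau>: "\<tau> > 0"
    have "F \<tau> y - F t y - (\<tau> - t) * time_average g t \<tau> y = 0"
    proof (rule continuous_constant_on_closure[where S = "{0<..<1}" and x = y
          and f = "\<lambda>y. F \<tau> y - F t y - (\<tau> - t) * time_average g t \<tau> y"])
      show "continuous_on (closure {0<..<1}) (\<lambda>y. F \<tau> y - F t y - (\<tau> - t) * time_average g t \<tau> y)"
        by (simp, intro continuous_intros F t \<tau> continuous_on_slice[OF avg]) (use \<tau> in auto)
      show "F \<tau> z - F t z - (\<tau> - t) * time_average g t \<tau> z = 0" if "z \<in> {0<..<1}" for z
        using increment_eq_time_average[of F z g t \<tau>] der t \<tau> that by simp
    qed (use y in simp)
    then show "F \<tau> y - F t y = (\<tau> - t) * time_average g t \<tau> y" by simp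
  qed
  then show ?thesis by (simp add: time_average_same)
qed

text \<open>The mixed derivative of \<open>F\<close> is not assumed to exist: the difference of the energies at two
  times factors as a product of a difference and a sum, and one integrates by parts before passing
  to the limit.\<close>

lemma has_derivative_energy:
  fixes F Fy Fyy Ft :: "real \<Rightarrow> real \<Rightarrow> real"
  assumes cy: "continuous_on ({0<..} \<times> {0..1}) (\<lambda>(t, y). Fy t y)"
    and cyy: "continuous_on ({0<..} \<times> {0..1}) (\<lambda>(t, y). Fyy t y)"
    and ct: "continuous_on ({0<..} \<times> {0..1}) (\<lambda>(t, y). Ft t y)"
    and dy: "\<And>t y. t > 0 \<Longrightarrow> y \<in> {0..1} \<Longrightarrow> (F t has_real_derivative Fy t y) (at y within {0..1})"
    and dyy: "\<And>t y. t > 0 \<Longrightarrow> y \<in> {0..1} \<Longrightarrow> (Fy t has_real_derivative Fyy t y) (at y within {0..1})"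
    and dt: "\<And>t y. t > 0 \<Longrightarrow> y \<in> {0..1} \<Longrightarrow> ((\<lambda>\<tau>. F \<tau> y) has_real_derivative Ft t y) (at t)"
    and t: "t > 0"
  shows "((\<lambda>t. integral {0..1} (\<lambda>y. (Fy t y)\<^sup>2)) has_real_derivative
     2 * (Ft t 1 * Fy t 1 - Ft t 0 * Fy t 0 - integral {0..1} (\<lambda>y. Ft t y * Fyy t y))) (at t)"
proof -
  define q where "q = time_average Ft t"
  have q: "F \<tau> y - F t y = (\<tau> - t) * q \<tau> y" if "\<tau> > 0" "y \<in> {0..1}" for \<tau> y
    unfolding q_def by (rule increment_eq_time_average[where F = F and g = Ft and y = y, OF dt[OF _ that(2)] t that(1)])
  have qt: "q t y = Ft t y" for y by (simp add: q_def time_average_same)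
  have cq: "continuous_on ({0<..} \<times> {0..1}) (\<lambda>(\<tau>, y). q \<tau> y)"
    unfolding q_def by (rule continuous_on_time_average[OF ct t])
  \<comment> \<open>The difference quotient of the energy after integration by parts. It involves
    only \<open>q\<close>, the quotient of \<open>F\<close>, and spatial derivatives, so it is
    continuous at \<open>\<tau> = t\<close>.\<close>
  define H where "H \<tau> = q \<tau> 1 * (Fy \<tau> 1 + Fy t 1) - q \<tau> 0 * (Fy \<tau> 0 + Fy t 0)
      - integral {0..1} (\<lambda>y. q \<tau> y * (Fyy \<tau> y + Fyy t y))" for \<tau>
  have c0: "continuous_on ({0<..} \<times> {0..1}) (\<lambda>(\<tau>, y). q \<tau> y * (Fyy \<tau> y + Fyy t y))"
  proof -
    have "continuous_on ({0<..} \<times> {0..1}) (\<lambda>x. Fyy t (snd x))"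
      by (rule continuous_on_compose2[OF continuous_on_slice[OF cyy]]) (use t in \<open>auto intro!: continuous_intros\<close>)
    then show ?thesis using cq cyy by (auto simp: case_prod_unfold intro!: continuous_intros)
  qed
  have cH: "continuous_on {0<..} H"
    unfolding H_def
    by (intro continuous_intros continuous_on_integral_param[OF c0]
         continuous_on_slice2[OF cq] continuous_on_slice2[OF cy]) auto
  have intsq: "(\<lambda>y. (Fy \<tau> y)\<^sup>2) integrable_on {0..1}" if "\<tau> > 0" for \<tau>
    by (intro integrable_continuous_interval continuous_intros continuous_on_slice[OF cy]) (use that in auto)
  have main: "integral {0..1} (\<lambda>y. (Fy \<tau> y)\<^sup>2) - integral {0..1} (\<lambda>y. (Fy t y)\<^sup>2) = (\<tau> - t) * H \<tau>"
    if "\<tau> > 0" for \<tau>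
  proof -
    \<comment> \<open>In the derivative of \<open>?f * ?g\<close> one term is the difference of the
      squared gradients; the other carries the factor \<open>\<tau> - t\<close> through
      \<open>q\<close>.\<close>
    let ?f = "\<lambda>y. F \<tau> y - F t y" and ?g = "\<lambda>y. Fy \<tau> y + Fy t y"
    have "((\<lambda>y. (Fy \<tau> y - Fy t y) * ?g y + ?f y * (Fyy \<tau> y + Fyy t y)) has_integral
        ?f 1 * ?g 1 - ?f 0 * ?g 0) {0..1}"
    proof (rule fundamental_theorem_of_calculus)
      fix y :: real assume y: "y \<in> {0..1}"
      note f = DERIV_diff[OF dy[OF that y] dy[OF t y]]
      note g = DERIV_add[OF dyy[OF that y] dyy[OF t y]]
      show "((\<lambda>y. ?f y * ?g y) has_vector_derivative
          (Fy \<tau> y - Fy t y) * ?g y + ?f y * (Fyy \<tau> y + Fyy t y)) (at y within {0..1})"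
        unfolding has_real_derivative_iff_has_vector_derivative[symmetric]
        by (rule DERIV_cong[OF DERIV_mult[OF f g]]) simp
    qed simp
    moreover have "((\<lambda>y. (\<tau> - t) * (q \<tau> y * (Fyy \<tau> y + Fyy t y))) has_integral
        (\<tau> - t) * integral {0..1} (\<lambda>y. q \<tau> y * (Fyy \<tau> y + Fyy t y))) {0..1}"
      by (intro has_integral_mult_right integrable_integral integrable_continuous_interval
          continuous_on_slice[OF c0]) (use that in simp)
    then have "((\<lambda>y. ?f y * (Fyy \<tau> y + Fyy t y)) has_integral
        (\<tau> - t) * integral {0..1} (\<lambda>y. q \<tau> y * (Fyy \<tau> y + Fyy t y))) {0..1}"
      by (rule has_integral_eq[rotated]) (simp only: q[OF that] mult.assoc)
    ultimately have "((\<lambda>y. ((Fy \<tau> y - Fy t y) * ?g y + ?f y * (Fyy \<tau> y + Fyy t y)) - ?f y * (Fyy \<tau> y + Fyy t y))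
       has_integral ?f 1 * ?g 1 - ?f 0 * ?g 0 - (\<tau> - t) * integral {0..1} (\<lambda>y. q \<tau> y * (Fyy \<tau> y + Fyy t y))) {0..1}"
      by (rule has_integral_diff)
    also have "?f 1 * ?g 1 - ?f 0 * ?g 0 - (\<tau> - t) * integral {0..1} (\<lambda>y. q \<tau> y * (Fyy \<tau> y + Fyy t y)) = (\<tau> - t) * H \<tau>"
      unfolding H_def q[OF that, of 0, simplified] q[OF that, of 1, simplified]
      by (simp add: algebra_simps)
    also have "(\<lambda>y. ((Fy \<tau> y - Fy t y) * ?g y + ?f y * (Fyy \<tau> y + Fyy t y)) - ?f y * (Fyy \<tau> y + Fyy t y))
       = (\<lambda>y. (Fy \<tau> y)\<^sup>2 - (Fy t y)\<^sup>2)"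
      by (simp add: power2_eq_square algebra_simps)
    finally have "integral {0..1} (\<lambda>y. (Fy \<tau> y)\<^sup>2 - (Fy t y)\<^sup>2) = (\<tau> - t) * H \<tau>"
      by (rule integral_unique)
    then show ?thesis using integral_diff[OF intsq[OF that] intsq[OF t]] by simp
  qed
  have "isCont H t" using cH t by (simp add: continuous_on_eq_continuous_at)
  then have "((\<lambda>t. integral {0..1} (\<lambda>y. (Fy t y)\<^sup>2)) has_real_derivative H t) (at t)"
    using t main by (rule derivative_of_factored_increment)
  moreover have "H t = 2 * (Ft t 1 * Fy t 1 - Ft t 0 * Fy t 0 - integral {0..1} (\<lambda>y. Ft t y * Fyy t y))"
    unfolding H_def qt by (simp add: algebra_simps flip: integral_mult_right)
  ultimately show ?thesis by simp
qed

section \<open>Differential inequalities\<close>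

text \<open>While the front \<open>s\<close> is below half of the setpoint, \<open>G\<close> relaxes to size \<open>s\<^sup>2\<close> within
  unit time, so that \<open>Y\<close> is of size \<open>s\<^sup>2\<close> and grows at a rate of order \<open>s\<close>, that is, of order
  \<open>sqrt Y\<close>.  The waiting time \<open>\<tau>\<close> does not depend on \<open>s 0\<close>.\<close>

lemma front_reaches_half:
  fixes s G Y :: "real \<Rightarrow> real" and sr C0 C1 k C q A m \<tau> :: real
  assumes pos: "sr > 0" "C0 > 0" "C1 > 0" "k > 0" "C > 0" "q > 0"
    and s: "\<And>t. t \<ge> 0 \<Longrightarrow> 0 < s t"
    and mono: "\<And>t t'. 0 \<le> t \<Longrightarrow> t \<le> t' \<Longrightarrow> s t \<le> s t'"
    and contG: "continuous_on {0..} G"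
    and G': "\<And>t. t > 0 \<Longrightarrow> \<exists>d. (G has_real_derivative d) (at t) \<and> d \<le> C1 * s t - k / s t * G t"
    and G: "\<And>t. t \<ge> 0 \<Longrightarrow> 0 \<le> G t" "\<And>t. t \<ge> 0 \<Longrightarrow> G t \<le> C0"
    and contY: "continuous_on {0..} Y"
    and Y': "\<And>t. t > 0 \<Longrightarrow> \<exists>d. (Y has_real_derivative d) (at t) \<and> q * s t * (sr - s t) \<le> d"
    and Y: "\<And>t. t \<ge> 0 \<Longrightarrow> 0 < Y t" "\<And>t. t \<ge> 0 \<Longrightarrow> Y t \<le> C * ((s t)\<^sup>2 + G t)"
    and A: "A = C * (1 + C1 / k + 2 * C0 / k\<^sup>2)"
    and m: "m = q * sr / (4 * sqrt A)"
    and \<tau>: "\<tau> = 1 + sqrt A * sr / m"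
  shows "sr / 2 \<le> s \<tau>"
proof (rule ccontr)
  assume "\<not> sr / 2 \<le> s \<tau>"
  then have s\<tau>: "s \<tau> < sr / 2" by simp
  have "A > 0" unfolding A using pos by (intro mult_pos_pos add_pos_pos divide_pos_pos) auto
  then have "m > 0" unfolding m using pos by simp
  then have "\<tau> \<ge> 1" unfolding \<tau> using pos \<open>A > 0\<close> by simp
  have relax: "G t \<le> (C1 / k + 2 * C0 / k\<^sup>2) * (s t)\<^sup>2" if "t \<ge> 1" for t
  proof -
    define \<sigma> where "\<sigma> = s t"
    have \<sigma>: "\<sigma> > 0" using s that by (simp add: \<sigma>_def)
    let ?g = "\<lambda>u. G u - C1 * \<sigma>\<^sup>2 / k"
    have "?g t \<le> ?g 0 * exp (- (k / \<sigma>) * (t - 0))"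
    proof (rule gronwall_le)
      show "continuous_on {0..t} ?g"
        by (intro continuous_intros continuous_on_subset[OF contG]) auto
      fix u assume u: "0 < u" "u < t"
      from G'[OF u(1)] obtain d where d: "(G has_real_derivative d) (at u)" "d \<le> C1 * s u - k / s u * G u" by blast
      have "s u \<le> \<sigma>" "0 < s u" using mono[of u t] s[of u] u by (auto simp: \<sigma>_def)
      then have "C1 * s u \<le> C1 * \<sigma>" "k / \<sigma> * G u \<le> k / s u * G u"
        using pos G(1)[of u] u by (auto intro!: mult_right_mono divide_left_mono)
      then have "d \<le> C1 * \<sigma> - k / \<sigma> * G u" using d(2) by linarith
      also have "\<dots> = - (k / \<sigma>) * ?g u" using \<sigma> pos by (simp add: field_simps power2_eq_square)
      finally show "\<exists>d. (?g has_real_derivative d) (at u) \<and> d \<le> - (k / \<sigma>) * ?g u"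
        using d(1) by (intro exI[of _ d]) (auto intro!: derivative_eq_intros)
    qed (use that in auto)
    also have "\<dots> \<le> C0 * exp (- (k / \<sigma>))"
    proof (rule mult_mono)
      have "0 \<le> C1 * \<sigma>\<^sup>2 / k" using pos by simp
      then show "?g 0 \<le> C0" using G(2)[of 0] by simp
      have "k / \<sigma> * 1 \<le> k / \<sigma> * t" using that pos \<sigma> by (intro mult_left_mono) auto
      then show "exp (- (k / \<sigma>) * (t - 0)) \<le> exp (- (k / \<sigma>))" by simp
    qed (use pos in auto)
    \<comment> \<open>After unit time the initial layer is damped by
      \<open>exp (- (k / \<sigma>))\<close>, which is of order \<open>\<sigma>\<^sup>2\<close>
      because \<open>exp z \<ge> z\<^sup>2 / 2\<close> for positive \<open>z\<close>. This makes the
      bound independent of \<open>s 0\<close>.\<close>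
    also have "exp (- (k / \<sigma>)) \<le> 2 * \<sigma>\<^sup>2 / k\<^sup>2"
    proof -
      have "(k / \<sigma>)\<^sup>2 / 2 \<le> exp (k / \<sigma>)"
        using exp_lower_Taylor_quadratic[of "k / \<sigma>"] pos \<sigma> divide_pos_pos[of k \<sigma>] by linarith
      then have "inverse (exp (k / \<sigma>)) \<le> inverse ((k / \<sigma>)\<^sup>2 / 2)"
        using pos \<sigma> by (intro le_imp_inverse_le) auto
      then show ?thesis by (simp add: exp_minus power_divide mult.commute)
    qed
    finally have "?g t \<le> C0 * (2 * \<sigma>\<^sup>2 / k\<^sup>2)" using pos by simp
    then show ?thesis by (simp add: \<sigma>_def algebra_simps)
  qed
  have Ys: "Y t \<le> A * (s t)\<^sup>2" if "t \<ge> 1" for t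
  proof -
    have "Y t \<le> C * ((s t)\<^sup>2 + G t)" using Y(2) that by simp
    also have "\<dots> \<le> C * ((s t)\<^sup>2 + (C1 / k + 2 * C0 / k\<^sup>2) * (s t)\<^sup>2)"
      using relax[OF that] pos by simp
    also have "\<dots> = A * (s t)\<^sup>2" unfolding A by (simp add: algebra_simps)
    finally show ?thesis .
  qed
  then have sqY: "sqrt (Y t) \<le> sqrt A * s t" if "t \<ge> 1" for t
    using real_sqrt_le_mono[OF Ys[OF that]] s[of t] that by (simp add: real_sqrt_mult)
  \<comment> \<open>From \<open>Y' \<ge> q * s * sr / 2\<close> and
    \<open>sqrt Y \<le> sqrt A * s\<close>, the function \<open>sqrt Y\<close> grows at rate at
    least \<open>m\<close>. By time \<open>\<tau>\<close> it would have gained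
    \<open>sqrt A * sr\<close>, more than its upper bound permits.\<close>
  have growth: "- sqrt (Y \<tau>) \<le> - sqrt (Y 1) + (- m) * (\<tau> - 1)"
  proof (rule deriv_bound_imp_bound[OF \<open>\<tau> \<ge> 1\<close>])
    show "continuous_on {1..\<tau>} (\<lambda>t. - sqrt (Y t))"
      by (intro continuous_intros continuous_on_subset[OF contY]) auto
    fix t assume t: "1 < t" "t < \<tau>"
    then obtain d where d: "(Y has_real_derivative d) (at t)" "q * s t * (sr - s t) \<le> d" using Y'[of t] by auto
    have Yt: "Y t > 0" and st: "s t > 0" "s t < sr / 2" using Y(1)[of t] s[of t] mono[of t \<tau>] s\<tau> t by auto
    have "q * s t * (sr / 2) \<le> q * s t * (sr - s t)" using st pos by (intro mult_left_mono) auto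
    then have d2: "q * s t * (sr / 2) \<le> d" using d(2) by linarith
    have "m * (2 * sqrt (Y t)) \<le> m * (2 * (sqrt A * s t))"
      using sqY[of t] t \<open>m > 0\<close> by (intro mult_left_mono) auto
    also have "\<dots> = q * s t * (sr / 2)" unfolding m using \<open>A > 0\<close> by (simp add: field_simps)
    finally have "m * (2 * sqrt (Y t)) \<le> d" using d2 by linarith
    then have "m \<le> d / (2 * sqrt (Y t))" using Yt by (simp add: field_simps)
    moreover have "((\<lambda>t. - sqrt (Y t)) has_real_derivative - (d / (2 * sqrt (Y t)))) (at t)"
      using Yt by (auto intro!: derivative_eq_intros d(1) simp: field_simps)
    ultimately show "\<exists>d. ((\<lambda>t. - sqrt (Y t)) has_real_derivative d) (at t) \<and> d \<le> - m"
      by (metis neg_le_iff_le)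
  qed
  have "(- m) * (\<tau> - 1) = - (sqrt A * sr)" unfolding \<tau> using \<open>m > 0\<close> by simp
  moreover have "sqrt (Y 1) > 0" using Y(1)[of 1] by simp
  moreover have "sqrt (Y \<tau>) \<le> sqrt A * s \<tau>" by (rule sqY) fact
  moreover have "sqrt A * s \<tau> \<le> sqrt A * sr" using s\<tau> pos \<open>A > 0\<close> by (intro mult_left_mono) auto
  ultimately show False using growth by linarith
qed

text \<open>For \<open>V = N + K * L\<^sup>2\<close>, the choice \<open>K * \<eta> = C2\<close> lets
  the damping of \<open>L\<^sup>2\<close> absorb the source in \<open>N'\<close> once
  \<open>s \<ge> sr / 2\<close>, with as much left over, so \<open>V\<close> decays at rate
  \<open>b\<close>. Before \<open>\<tau>\<close> only growth at rate \<open>\<eta>\<close> is used;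
  the factor \<open>exp ((\<eta> + b) * \<tau>)\<close> pays for it.\<close>

lemma coupled_decay:
  fixes s L N :: "real \<Rightarrow> real" and sr k1 \<eta>1 C2 \<eta> b K \<tau> :: real
  assumes pos: "sr > 0" "k1 > 0" "\<eta>1 > 0" "C2 > 0" "\<tau> \<ge> 0"
    and s: "\<And>t. t \<ge> 0 \<Longrightarrow> 0 < s t"
    and mono: "\<And>t t'. 0 \<le> t \<Longrightarrow> t \<le> t' \<Longrightarrow> s t \<le> s t'"
    and half: "sr / 2 \<le> s \<tau>"
    and contL: "continuous_on {0..} L" and contN: "continuous_on {0..} N"
    and L': "\<And>t. t > 0 \<Longrightarrow> \<exists>d. (L has_real_derivative d) (at t) \<and> d \<le> - k1 * s t * L t"
    and N': "\<And>t. t > 0 \<Longrightarrow> \<exists>d. (N has_real_derivative d) (at t) \<and> d \<le> - \<eta>1 * N t + C2 * (L t)\<^sup>2"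
    and nonneg: "\<And>t. t \<ge> 0 \<Longrightarrow> 0 \<le> L t" "\<And>t. t \<ge> 0 \<Longrightarrow> 0 \<le> N t"
    and \<eta>: "\<eta> = k1 * sr / 2" and b: "b = min \<eta>1 \<eta>" and K: "K = C2 / \<eta>"
    and t: "t \<ge> 0"
  shows "N t + K * (L t)\<^sup>2 \<le> (N 0 + K * (L 0)\<^sup>2) * exp ((\<eta> + b) * \<tau>) * exp (- b * t)"
proof -
  define V where "V t = N t + K * (L t)\<^sup>2" for t
  have \<eta>0: "\<eta> > 0" and b0: "b > 0" and K0: "K > 0" using pos by (auto simp: \<eta> b K)
  have K\<eta>: "K * \<eta> = C2" using \<eta>0 by (simp add: K)
  have V0: "V t \<ge> 0" if "t \<ge> 0" for t using nonneg[OF that] K0 by (simp add: V_def)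
  have contV: "continuous_on {u..v} V" if "0 \<le> u" for u v
    unfolding V_def by (intro continuous_intros continuous_on_subset[OF contL] continuous_on_subset[OF contN])
       (use that in auto)
  have V': "\<exists>d. (V has_real_derivative d) (at t) \<and>
      d \<le> - \<eta>1 * N t + C2 * (L t)\<^sup>2 - 2 * K * (k1 * s t) * (L t)\<^sup>2" if "t > 0" for t
  proof -
    from L'[OF that] obtain l where l: "(L has_real_derivative l) (at t)" "l \<le> - k1 * s t * L t" by blast
    from N'[OF that] obtain n where n: "(N has_real_derivative n) (at t)" "n \<le> - \<eta>1 * N t + C2 * (L t)\<^sup>2" by blast
    have "(V has_real_derivative n + 2 * K * L t * l) (at t)"
      unfolding V_def by (auto intro!: derivative_eq_intros l(1) n(1))
    moreover have "2 * K * L t * l \<le> 2 * K * L t * (- k1 * s t * L t)"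
      using l(2) K0 nonneg(1)[of t] that by (intro mult_left_mono) auto
    ultimately show ?thesis using n(2)
      by (intro exI[of _ "n + 2 * K * L t * l"]) (auto simp: power2_eq_square algebra_simps)
  qed
  have early: "V t \<le> V 0 * exp (\<eta> * (t - 0))" if "t \<ge> 0" for t
  proof (rule gronwall_le[OF that contV])
    fix u assume u: "0 < u" "u < t"
    from V'[OF u(1)] obtain d where d: "(V has_real_derivative d) (at u)"
      "d \<le> - \<eta>1 * N u + C2 * (L u)\<^sup>2 - 2 * K * (k1 * s u) * (L u)\<^sup>2" by blast
    have "0 \<le> 2 * K * (k1 * s u) * (L u)\<^sup>2" "0 \<le> \<eta>1 * N u" "0 \<le> \<eta> * N u"
      using K0 pos s[of u] u nonneg[of u] \<eta>0 by auto
    moreover have "\<eta> * V u = \<eta> * N u + C2 * (L u)\<^sup>2" by (simp add: V_def K\<eta>[symmetric] algebra_simps)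
    ultimately have "d \<le> \<eta> * V u" using d(2) by linarith
    with d(1) show "\<exists>d. (V has_real_derivative d) (at u) \<and> d \<le> \<eta> * V u" by blast
  qed auto
  have "V t \<le> V 0 * exp ((\<eta> + b) * \<tau>) * exp (- b * t)"
  proof (cases "t \<le> \<tau>")
    case True
    have "\<eta> * t + b * t \<le> \<eta> * \<tau> + b * \<tau>" using True \<eta>0 b0 by (intro add_mono mult_left_mono) auto
    then have "exp (\<eta> * (t - 0)) \<le> exp ((\<eta> + b) * \<tau> + (- b * t))" by (simp add: algebra_simps)
    then have "V 0 * exp (\<eta> * (t - 0)) \<le> V 0 * exp ((\<eta> + b) * \<tau> + (- b * t))"
      using V0[of 0] by (intro mult_left_mono) auto
    with early[OF t] show ?thesis unfolding exp_add by (simp add: mult.assoc)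
  next
    case False
    then have "\<tau> \<le> t" by simp
    have "V t \<le> V \<tau> * exp (- b * (t - \<tau>))"
    proof (rule gronwall_le[OF \<open>\<tau> \<le> t\<close> contV])
      fix u assume u: "\<tau> < u" "u < t"
      then have "u > 0" using pos by simp
      from V'[OF this] obtain d where d: "(V has_real_derivative d) (at u)"
        "d \<le> - \<eta>1 * N u + C2 * (L u)\<^sup>2 - 2 * K * (k1 * s u) * (L u)\<^sup>2" by blast
      have "sr / 2 \<le> s u" using half mono[of \<tau> u] u pos by linarith
      then have "k1 * (sr / 2) \<le> k1 * s u" using pos by (intro mult_left_mono) auto
      then have "2 * K * \<eta> * (L u)\<^sup>2 \<le> 2 * K * (k1 * s u) * (L u)\<^sup>2"
        using K0 \<eta> by (intro mult_right_mono mult_left_mono) auto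
      moreover have "2 * K * \<eta> * (L u)\<^sup>2 = 2 * C2 * (L u)\<^sup>2" by (simp add: K\<eta>[symmetric])
      moreover have "b * N u \<le> \<eta>1 * N u" using nonneg(2)[of u] \<open>u > 0\<close> by (intro mult_right_mono) (auto simp: b)
      moreover have "b * (K * (L u)\<^sup>2) \<le> \<eta> * (K * (L u)\<^sup>2)" using K0 by (intro mult_right_mono) (auto simp: b)
      moreover have "\<eta> * (K * (L u)\<^sup>2) = C2 * (L u)\<^sup>2" by (simp add: K\<eta>[symmetric])
      moreover have "b * V u = b * N u + b * (K * (L u)\<^sup>2)" by (simp add: V_def algebra_simps)
      ultimately have "d \<le> - b * V u" using d(2) by simp
      with d(1) show "\<exists>d. (V has_real_derivative d) (at u) \<and> d \<le> - b * V u" by blast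
    qed (use pos in auto)
    also have "\<dots> \<le> (V 0 * exp (\<eta> * (\<tau> - 0))) * exp (- b * (t - \<tau>))"
      using early[of \<tau>] pos by (intro mult_right_mono) auto
    also have "\<dots> = V 0 * exp ((\<eta> + b) * \<tau>) * exp (- b * t)"
      by (simp add: algebra_simps flip: exp_add)
    finally show ?thesis .
  qed
  then show ?thesis by (simp add: V_def)
qed

section \<open>The problem on the unit interval\<close>

text \<open>Integration by parts; \<open>y ^ Suc k\<close> vanishes at \<open>0\<close>, so only the
  boundary value at \<open>1\<close> survives.\<close>

lemma integral_power_times_deriv:
  fixes F f :: "real \<Rightarrow> real"
  assumes F: "\<And>y. y \<in> {0..1} \<Longrightarrow> (F has_real_derivative f y) (at y within {0..1})"
    and f: "continuous_on {0..1} f"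
  shows "integral {0..1} (\<lambda>y. y ^ Suc k * f y) = F 1 - real (Suc k) * integral {0..1} (\<lambda>y. y ^ k * F y)"
proof -
  have cF: "continuous_on {0..1} F" using F by (metis DERIV_continuous continuous_on_eq_continuous_within)
  have "((\<lambda>y. real (Suc k) * y ^ k * F y + y ^ Suc k * f y) has_integral 1 ^ Suc k * F 1 - 0 ^ Suc k * F 0) {0..1}"
    by (rule fundamental_theorem_of_calculus)
      (auto intro!: derivative_eq_intros F simp flip: has_real_derivative_iff_has_vector_derivative power_Suc)
  moreover have "((\<lambda>y. real (Suc k) * y ^ k * F y) has_integral integral {0..1} (\<lambda>y. real (Suc k) * y ^ k * F y)) {0..1}"
    by (intro integrable_integral integrable_continuous_interval continuous_intros cF)
  ultimately have "((\<lambda>y. (real (Suc k) * y ^ k * F y + y ^ Suc k * f y) - real (Suc k) * y ^ k * F y) has_integral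
     (1 ^ Suc k * F 1 - 0 ^ Suc k * F 0) - integral {0..1} (\<lambda>y. real (Suc k) * y ^ k * F y)) {0..1}"
    by (rule has_integral_diff)
  from integral_unique[OF this] show ?thesis by (simp add: mult.assoc)
qed

lemma deriv_nonpos_at_right_zero:
  fixes f :: "real \<Rightarrow> real"
  assumes "(f has_real_derivative d) (at 1 within {0..1})" "f 1 = 0"
    and "\<And>y. y \<in> {0..1} \<Longrightarrow> 0 \<le> f y"
  shows "d \<le> 0"
proof (rule ccontr)
  assume "\<not> d \<le> 0"
  then obtain e where e: "e > 0" "\<And>h. 0 < h \<Longrightarrow> 1 - h \<in> {0..1} \<Longrightarrow> h < e \<Longrightarrow> f (1 - h) < f 1"
    using has_real_derivative_pos_inc_left[OF assms(1)] by auto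
  define h where "h = min e 1 / 2"
  have "0 < h" "h < e" "1 - h \<in> {0..1}" using e(1) by (auto simp: h_def min_def)
  with e(2)[of h] assms(2) assms(3)[of "1 - h"] show False by auto
qed

text \<open>The closed loop in the coordinates \<open>y = x / s t\<close>, with \<open>U t y = T (y * s t) t - Tm\<close>.\<close>

locale normalized_stefan =
  fixes \<alpha> \<beta> \<epsilon>1 \<epsilon>2 c sr :: real and s :: "real \<Rightarrow> real" and U Uy Uyy Ut :: "real \<Rightarrow> real \<Rightarrow> real"
    and \<kappa> \<nu> :: real
  assumes params: "\<alpha> > 0" "\<beta> > 0" "\<epsilon>1 > -1" "\<epsilon>2 > -1" "\<epsilon>1 \<ge> \<epsilon>2" "c > 0" "sr > 0"
    and \<kappa>_def: "\<kappa> = \<alpha> * (1 + \<epsilon>1)" and \<nu>_def: "\<nu> = \<beta> * (1 + \<epsilon>2)"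
    and s_pos: "\<And>t. t \<ge> 0 \<Longrightarrow> s t > 0"
    and cont_s: "continuous_on {0..} s"
    and cont_U: "continuous_on ({0..} \<times> {0..1}) (\<lambda>(t, y). U t y)"
    and cont_Uy: "continuous_on ({0..} \<times> {0..1}) (\<lambda>(t, y). Uy t y)"
    and cont_Uyy: "continuous_on ({0<..} \<times> {0..1}) (\<lambda>(t, y). Uyy t y)"
    and cont_Ut: "continuous_on ({0<..} \<times> {0..1}) (\<lambda>(t, y). Ut t y)"
    and dU_y: "\<And>t y. t \<ge> 0 \<Longrightarrow> y \<in> {0..1} \<Longrightarrow> (U t has_real_derivative Uy t y) (at y within {0..1})"
    and dU_yy: "\<And>t y. t > 0 \<Longrightarrow> y \<in> {0..1} \<Longrightarrow> (Uy t has_real_derivative Uyy t y) (at y within {0..1})"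
    and dU_t: "\<And>t y. t > 0 \<Longrightarrow> y \<in> {0..1} \<Longrightarrow> ((\<lambda>\<tau>. U \<tau> y) has_real_derivative Ut t y) (at t)"
    and pde: "\<And>t y. t > 0 \<Longrightarrow> y \<in> {0..1} \<Longrightarrow> Ut t y = (\<kappa> * Uyy t y - \<nu> * Uy t 1 * (y * Uy t y)) / (s t)\<^sup>2"
    and ds: "\<And>t. t > 0 \<Longrightarrow> (s has_real_derivative - \<nu> * Uy t 1 / s t) (at t)"
    and U1: "\<And>t. t \<ge> 0 \<Longrightarrow> U t 1 = 0"
    and U0: "\<And>t. t \<ge> 0 \<Longrightarrow>
        U t 0 = - c * ((s t)\<^sup>2 * integral {0..1} (\<lambda>y. y * U t y) / \<alpha> + s t * (s t - sr) / \<beta>)"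
    and init: "\<And>y. y \<in> {0..1} \<Longrightarrow> U 0 y \<ge> 0"
    and setpoint: "(s 0)\<^sup>2 / (2 * \<beta>) + (s 0)\<^sup>2 * integral {0..1} (\<lambda>y. y * U 0 y) / \<alpha> < sr\<^sup>2 / (2 * \<beta>)"
begin

text \<open>In the original coordinate \<open>x\<close>, \<open>p\<close> is \<open>- s u\<^sub>x(s)\<close> and \<open>M k\<close> is the moment \<open>\<integral> x\<^sup>k u\<close>;
  \<open>N\<close> below is \<open>\<integral> u\<^sub>x\<^sup>2\<close>.\<close>

definition p :: "real \<Rightarrow> real" where "p t = - Uy t 1"

definition M :: "nat \<Rightarrow> real \<Rightarrow> real" where
  "M k t = s t ^ Suc k * integral {0..1} (\<lambda>y. y ^ k * U t y)"

lemma \<kappa>_pos: "\<kappa> > 0" and \<nu>_pos: "\<nu> > 0"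
  using params by (auto simp: \<kappa>_def \<nu>_def)

lemma cont_slice: "t \<ge> 0 \<Longrightarrow> continuous_on {0..1} (U t)" "t \<ge> 0 \<Longrightarrow> continuous_on {0..1} (Uy t)"
   "t > 0 \<Longrightarrow> continuous_on {0..1} (Uyy t)" "t > 0 \<Longrightarrow> continuous_on {0..1} (Ut t)"
  by (auto intro!: continuous_on_slice[OF cont_U] continuous_on_slice[OF cont_Uy]
     continuous_on_slice[OF cont_Uyy] continuous_on_slice[OF cont_Ut])

lemma cont_U0: "continuous_on {0..} (\<lambda>t. U t 0)" and cont_Uy1: "continuous_on {0..} (\<lambda>t. Uy t 1)"
  by (auto intro!: continuous_on_slice2[OF cont_U] continuous_on_slice2[OF cont_Uy])

lemma ds': "t > 0 \<Longrightarrow> (s has_real_derivative \<nu> * p t / s t) (at t)"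
  using ds by (simp add: p_def)

section \<open>Evolution of the moments and of the boundary value\<close>

lemma cont_M: "continuous_on {0..} (M k)"
proof -
  have "continuous_on ({0..} \<times> {0..1}) (\<lambda>(t, y). y ^ k * U t y)"
    using cont_U by (auto simp: case_prod_unfold intro!: continuous_intros)
  then show ?thesis unfolding M_def
    by (intro continuous_intros cont_s continuous_on_integral_param)
qed

lemma M1_eq: "M (Suc 0) t = (s t)\<^sup>2 * integral {0..1} (\<lambda>y. y * U t y)"
  by (simp add: M_def power2_eq_square)

lemma U0_eq: "t \<ge> 0 \<Longrightarrow> U t 0 = - c * (M (Suc 0) t / \<alpha> + s t * (s t - sr) / \<beta>)"
  by (simp add: U0 M1_eq)

text \<open>Leibniz' rule, the equation for \<open>Ut\<close> and integration by parts. Since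
  \<open>U\<close> vanishes at the front, the drift caused by the moving coordinate cancels the
  derivative of the factor \<open>s t ^ Suc (Suc i)\<close> exactly.\<close>

lemma dM:
  assumes t: "t > 0"
  shows "(M (Suc i) has_real_derivative
     \<kappa> * s t ^ i * (- p t - real (Suc i) * integral {0..1} (\<lambda>y. y ^ i * Uy t y))) (at t)"
proof -
  let ?k = "Suc i"
  let ?m = "\<lambda>t. integral {0..1} (\<lambda>y. y ^ ?k * U t y)"
  let ?J = "- p t - real (Suc i) * integral {0..1} (\<lambda>y. y ^ i * Uy t y)"
  have "(?m has_real_derivative integral {0..1} (\<lambda>y. y ^ ?k * Ut t y)) (at t within {0<..})"
    unfolding box_real(2)[symmetric]
  proof (rule leibniz_rule_field_derivative)
    fix u y :: real assume "u \<in> {0<..}" "y \<in> cbox 0 1"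
    then have "((\<lambda>t. y ^ ?k * U t y) has_real_derivative y ^ ?k * Ut u y) (at u)"
      by (intro DERIV_cmult dU_t) auto
    then show "((\<lambda>t. y ^ ?k * U t y) has_real_derivative y ^ ?k * Ut u y) (at u within {0<..})"
      by (rule has_field_derivative_at_within)
  next
    fix u :: real assume "u \<in> {0<..}"
    then show "(\<lambda>y. y ^ ?k * U u y) integrable_on cbox 0 1"
      unfolding box_real by (intro integrable_continuous_interval continuous_intros cont_slice) auto
  next
    show "continuous_on ({0<..} \<times> cbox 0 1) (\<lambda>(u, y). y ^ ?k * Ut u y)"
      using cont_Ut by (auto simp: case_prod_unfold intro!: continuous_intros)
  qed (use t in auto)
  then have dm: "(?m has_real_derivative integral {0..1} (\<lambda>y. y ^ ?k * Ut t y)) (at t)"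
    using t by (simp add: at_within_open[of t "{0<..}"])
  have st: "s t > 0" using s_pos t by simp
  have i1: "integral {0..1} (\<lambda>y. y ^ ?k * Uyy t y) = ?J"
    using integral_power_times_deriv[OF dU_yy[OF t] cont_slice(3)[OF t], of i] by (simp add: p_def)
  have i2: "integral {0..1} (\<lambda>y. y ^ Suc ?k * Uy t y) = - (real (Suc ?k) * ?m t)"
    using integral_power_times_deriv[OF dU_y[of t] cont_slice(2)[of t], of ?k] t U1[of t] by simp
  have "integral {0..1} (\<lambda>y. y ^ ?k * Ut t y) =
      integral {0..1} (\<lambda>y. \<kappa> / (s t)\<^sup>2 * (y ^ ?k * Uyy t y) + \<nu> * p t / (s t)\<^sup>2 * (y ^ Suc ?k * Uy t y))"
  proof (rule integral_cong)
    fix y :: real assume y: "y \<in> {0..1}"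
    show "y ^ ?k * Ut t y = \<kappa> / (s t)\<^sup>2 * (y ^ ?k * Uyy t y) + \<nu> * p t / (s t)\<^sup>2 * (y ^ Suc ?k * Uy t y)"
      unfolding pde[OF t y] p_def by (simp add: diff_divide_distrib algebra_simps)
  qed
  also have "\<dots> = \<kappa> / (s t)\<^sup>2 * ?J - \<nu> * p t / (s t)\<^sup>2 * (real (Suc ?k) * ?m t)"
    by (subst integral_add)
      (use t in \<open>auto intro!: integrable_continuous_interval continuous_intros cont_slice simp: i1 i2 st[THEN less_imp_neq, symmetric] simp del: power_Suc\<close>)
  finally have i3: "integral {0..1} (\<lambda>y. y ^ ?k * Ut t y) =
      \<kappa> / (s t)\<^sup>2 * ?J - \<nu> * p t / (s t)\<^sup>2 * (real (Suc ?k) * ?m t)" .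
  have "(M ?k has_real_derivative real (Suc ?k) * s t ^ ?k * (\<nu> * p t / s t) * ?m t +
     s t ^ Suc ?k * (\<kappa> / (s t)\<^sup>2 * ?J - \<nu> * p t / (s t)\<^sup>2 * (real (Suc ?k) * ?m t))) (at t)"
    unfolding M_def[abs_def] i3[symmetric]
    by (rule DERIV_cong[OF DERIV_mult[OF DERIV_power[OF ds'[OF t]] dm]]) (simp add: algebra_simps)
  moreover have "real (Suc ?k) * s t ^ ?k * (\<nu> * p t / s t) * ?m t +
     s t ^ Suc ?k * (\<kappa> / (s t)\<^sup>2 * ?J - \<nu> * p t / (s t)\<^sup>2 * (real (Suc ?k) * ?m t)) = \<kappa> * s t ^ i * ?J"
  proof -
    have "s t ^ ?k = s t * s t ^ i" "s t ^ Suc ?k = (s t)\<^sup>2 * s t ^ i" by (auto simp: power2_eq_square)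
    then show ?thesis using st by (simp add: divide_simps) (simp add: algebra_simps power2_eq_square)
  qed
  ultimately show ?thesis by simp
qed

lemma dM1: assumes t: "t > 0" shows "(M (Suc 0) has_real_derivative \<kappa> * (U t 0 - p t)) (at t)"
proof -
  have "(Uy t has_integral U t 1 - U t 0) {0..1}"
    by (rule fundamental_theorem_of_calculus)
      (use dU_y t in \<open>auto simp flip: has_real_derivative_iff_has_vector_derivative\<close>)
  then have "integral {0..1} (Uy t) = - U t 0" using U1[of t] t by (simp add: integral_unique)
  then show ?thesis using dM[OF t, of 0] by simp
qed

text \<open>The weight \<open>x ^ (j + 2)\<close> and its slope vanish at \<open>x = 0\<close>, so a
  second integration by parts brings in no control term and leaves a moment two orders
  lower.\<close>

lemma dM_Suc:
  assumes t: "t > 0"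
  shows "(M (Suc (Suc j)) has_real_derivative
    - \<kappa> * s t ^ Suc j * p t + \<kappa> * real (Suc (Suc j)) * real (Suc j) * M j t) (at t)"
proof -
  have I: "integral {0..1} (\<lambda>y. y ^ Suc j * Uy t y) = - (real (Suc j) * integral {0..1} (\<lambda>y. y ^ j * U t y))"
    using integral_power_times_deriv[OF dU_y[of t] cont_slice(2)[of t], of j] t U1[of t] by simp
  show ?thesis
    by (rule DERIV_cong[OF dM[OF t, of "Suc j"]]) (unfold I M_def, simp add: algebra_simps)
qed

definition B :: "real \<Rightarrow> real" where "B t = (\<epsilon>1 - \<epsilon>2) * s t + (1 + \<epsilon>2) * (sr - s t)"

lemma dU0:
  assumes t: "t > 0"
  shows "((\<lambda>t. U t 0) has_real_derivative - c * (1 + \<epsilon>1) * U t 0 + c * p t * B t / s t) (at t)"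
proof -
  have st: "s t > 0" using s_pos t by simp
  have "((\<lambda>t. - c * (M (Suc 0) t / \<alpha> + s t * (s t - sr) / \<beta>)) has_real_derivative
     - c * (\<kappa> * (U t 0 - p t) / \<alpha> + (\<nu> * p t / s t * (s t - sr) + s t * (\<nu> * p t / s t)) / \<beta>)) (at t)"
    using params st by (auto intro!: derivative_eq_intros dM1[OF t] ds'[OF t])
  moreover have "- c * (\<kappa> * (U t 0 - p t) / \<alpha> + (\<nu> * p t / s t * (s t - sr) + s t * (\<nu> * p t / s t)) / \<beta>)
      = - c * (1 + \<epsilon>1) * U t 0 + c * p t * B t / s t"
    using params st by (simp add: \<kappa>_def \<nu>_def B_def field_simps)
  ultimately have "((\<lambda>t. - c * (M (Suc 0) t / \<alpha> + s t * (s t - sr) / \<beta>)) has_real_derivative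
       - c * (1 + \<epsilon>1) * U t 0 + c * p t * B t / s t) (at t)" by simp
  then show ?thesis
    by (rule has_field_derivative_transform_within_open[of _ _ _ "{0<..}"])
      (use t U0_eq in auto)
qed

section \<open>Preservation of signs\<close>

text \<open>The barrier \<open>m * (1 - y ^ n)\<close> with \<open>n = j + 2\<close> compensates a
  boundary value down to \<open>- m\<close>. It is a supersolution because its diffusion, of
  strength \<open>\<kappa> * (n - 1)\<close>, dominates the drift; hence the exponent depends on a
  bound for \<open>p\<close>. At the front it vanishes with slope \<open>- n * m\<close>, so it
  controls the flux linearly in \<open>m\<close>.\<close>

lemma U_ge_barrier:
  assumes ti: "0 \<le> t0" "t \<in> {t0..t1}" "y \<in> {0..1}" and m: "m \<ge> 0"
    and init: "\<And>y. y \<in> {0..1} \<Longrightarrow> U t0 y \<ge> 0"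
    and left: "\<And>t. t \<in> {t0..t1} \<Longrightarrow> U t 0 \<ge> - m"
    and slow: "\<And>t. t \<in> {t0..t1} \<Longrightarrow> \<nu> * \<bar>p t\<bar> \<le> \<kappa> * real (Suc j)"
  shows "U t y + m * (1 - y ^ Suc (Suc j)) \<ge> 0"
proof -
  let ?n = "Suc (Suc j)"
  let ?V = "\<lambda>t y. U t y + m * (1 - y ^ ?n)"
  let ?Vy = "\<lambda>t y. Uy t y - m * (real ?n * y ^ Suc j)"
  let ?Vyy = "\<lambda>t y. Uyy t y - m * (real ?n * (real (Suc j) * y ^ j))"
  have "0 \<le> ?V t y"
  proof (rule parabolic_min_principle[where V = ?V and ?t0.0 = t0 and ?t1.0 = t1 and Vt = Ut and Vy = ?Vy and Vyy = ?Vyy and D = "\<lambda>t y. \<kappa> / (s t)\<^sup>2"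
        and e = "\<lambda>t y. \<nu> * p t * y / (s t)\<^sup>2"])
    show "continuous_on ({t0..t1} \<times> {0..1}) (\<lambda>(t, y). ?V t y)"
    proof -
      have "continuous_on ({t0..t1} \<times> {0..1}) (\<lambda>(t, y). U t y)"
        by (rule continuous_on_subset[OF cont_U]) (use ti in auto)
      then show ?thesis by (auto simp: case_prod_unfold intro!: continuous_intros)
    qed
    fix t y :: real assume t: "t0 < t" "t \<le> t1" and y: "0 < y" "y < 1"
    then have t0: "t > 0" using ti by simp
    have y01: "y \<in> {0..1}" using y by simp
    have at: "at y within {0..1} = at y" using y by (simp add: at_within_Icc_at)
    show "((\<lambda>\<tau>. ?V \<tau> y) has_real_derivative Ut t y) (at t)"
      using dU_t[OF t0, of y] y by (auto intro!: derivative_eq_intros)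
    show "(?V t has_real_derivative ?Vy t y) (at y)"
      using dU_y[of t y] t0 y unfolding at
      by (auto intro!: derivative_eq_intros simp del: power_Suc)
    show "(?Vy t has_real_derivative ?Vyy t y) (at y)"
      using dU_yy[OF t0, of y] y unfolding at
      by (auto intro!: derivative_eq_intros simp del: power_Suc)
    show "\<kappa> / (s t)\<^sup>2 \<ge> 0" using \<kappa>_pos by simp
    have "\<nu> * \<bar>p t\<bar> \<le> \<kappa> * real (Suc j)" using slow t by simp
    moreover have "y\<^sup>2 \<le> 1" using y by (simp add: power_le_one)
    ultimately have "\<nu> * \<bar>p t\<bar> * y\<^sup>2 \<le> \<kappa> * real (Suc j) * 1"
      by (rule mult_mono) (use \<kappa>_pos in auto)
    moreover have "- (\<nu> * \<bar>p t\<bar> * y\<^sup>2) \<le> \<nu> * p t * y\<^sup>2"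
    proof -
      have "\<nu> * y\<^sup>2 * (- \<bar>p t\<bar>) \<le> \<nu> * y\<^sup>2 * p t"
        using \<nu>_pos by (intro mult_left_mono) auto
      then show ?thesis by (simp add: algebra_simps)
    qed
    ultimately have ge: "0 \<le> \<kappa> * real (Suc j) + \<nu> * p t * y\<^sup>2" by linarith
    have "\<kappa> / (s t)\<^sup>2 * ?Vyy t y + \<nu> * p t * y / (s t)\<^sup>2 * ?Vy t y
        = Ut t y - m * real ?n * y ^ j * (\<kappa> * real (Suc j) + \<nu> * p t * y\<^sup>2) / (s t)\<^sup>2"
      unfolding pde[OF t0 y01] p_def using s_pos[of t] t0
      by (simp add: field_simps power2_eq_square)
    also have "\<dots> \<le> Ut t y"
      using ge m y by simp
    finally show "Ut t y \<ge> \<kappa> / (s t)\<^sup>2 * ?Vyy t y + \<nu> * p t * y / (s t)\<^sup>2 * ?Vy t y" .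
  next
    fix y :: real assume "y \<in> {0..1}"
    then show "0 \<le> ?V t0 y" using init[of y] m power_le_one[of y ?n] by (auto simp del: power_Suc)
  next
    fix t assume t: "t \<in> {t0..t1}"
    show "0 \<le> ?V t 0" using left[OF t] by simp
    show "0 \<le> ?V t 1" using U1[of t] t ti by simp
  qed (use ti in auto)
  then show ?thesis .
qed

definition R :: "real \<Rightarrow> real" where
  "R t = (sr\<^sup>2 - (s t)\<^sup>2) / (2 * \<beta>) - M (Suc 0) t / \<alpha>"

lemma M_nonneg:
  assumes "t \<ge> 0" "\<And>y. y \<in> {0..1} \<Longrightarrow> U t y \<ge> 0"
  shows "M k t \<ge> 0"
  unfolding M_def using s_pos[of t] assms
  by (intro mult_nonneg_nonneg integral_nonneg integrable_continuous_interval continuous_intros cont_slice) auto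

lemma signs_until:
  assumes T: "T \<ge> 0" and left: "\<And>t. t \<in> {0..T} \<Longrightarrow> U t 0 \<ge> 0" and t: "t \<in> {0..T}"
  shows "\<And>y. y \<in> {0..1} \<Longrightarrow> U t y \<ge> 0" "p t \<ge> 0" "s t < sr"
proof -
  obtain j where j: "\<And>t. t \<in> {0..T} \<Longrightarrow> \<nu> * \<bar>p t\<bar> \<le> \<kappa> * real (Suc j)"
  proof -
    have "continuous_on {0..T} (\<lambda>t. \<bar>p t\<bar>)" unfolding p_def
      by (intro continuous_intros continuous_on_subset[OF cont_Uy1]) auto
    then have "\<exists>u\<in>{0..T}. \<forall>t\<in>{0..T}. \<bar>p t\<bar> \<le> \<bar>p u\<bar>"
      using T by (intro continuous_attains_sup) auto
    then obtain tm where tm: "\<And>t. t \<in> {0..T} \<Longrightarrow> \<bar>p t\<bar> \<le> \<bar>p tm\<bar>" by blast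
    obtain j :: nat where "\<nu> * \<bar>p tm\<bar> / \<kappa> \<le> real j" using real_arch_simple by blast
    then have "\<nu> * \<bar>p tm\<bar> \<le> \<kappa> * real (Suc j)" using \<kappa>_pos by (simp add: field_simps)
    then have "\<nu> * \<bar>p t\<bar> \<le> \<kappa> * real (Suc j)" if "t \<in> {0..T}" for t
      using mult_left_mono[OF tm[OF that], of \<nu>] \<nu>_pos by linarith
    with that show ?thesis by blast
  qed
  have U: "U t y \<ge> 0" if "t \<in> {0..T}" "y \<in> {0..1}" for t y
    using U_ge_barrier[of 0 t T y 0 j] that init left j by simp
  have p: "p t \<ge> 0" if "t \<in> {0..T}" for t
    using deriv_nonpos_at_right_zero[OF dU_y[of t 1]] U1[of t] U that by (auto simp: p_def)
  from t show "\<And>y. y \<in> {0..1} \<Longrightarrow> U t y \<ge> 0" "p t \<ge> 0" using U p by auto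
  \<comment> \<open>The difference is \<open>c / (2 * \<beta>)\<close> times the square of
    \<open>sr - s t\<close>; this closes the inequality for \<open>R\<close>.\<close>
  have U0_R: "U t 0 \<le> c * R t" if "t \<in> {0..T}" for t
  proof -
    have t0: "t \<ge> 0" using that by simp
    have "c * R t - U t 0 = c * (sr - s t)\<^sup>2 / (2 * \<beta>)"
      unfolding R_def U0_eq[OF t0] using params by (simp add: field_simps power2_eq_square)
    also have "\<dots> \<ge> 0" using params by simp
    finally show ?thesis by simp
  qed
  have "R 0 * exp (- (1 + \<epsilon>1) * c * (t - 0)) \<le> R t"
  proof (rule gronwall_ge)
    show "continuous_on {0..t} R" unfolding R_def
      by (intro continuous_intros continuous_on_subset[OF cont_s] continuous_on_subset[OF cont_M]) (use params in auto)
    fix u assume u: "0 < u" "u < t"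
    then have uT: "u \<in> {0..T}" "s u > 0" using t s_pos by auto
    \<comment> \<open>Here \<open>\<epsilon>1 \<ge> \<epsilon>2\<close> enters: with
      \<open>p u \<ge> 0\<close> the flux term only helps.\<close>
    have "(R has_real_derivative (\<epsilon>1 - \<epsilon>2) * p u - (1 + \<epsilon>1) * U u 0) (at u)"
      unfolding R_def
      by (rule DERIV_cong[OF DERIV_diff[OF DERIV_cdivide[OF DERIV_diff[OF DERIV_const DERIV_power[OF ds'[OF u(1)]]]]
            DERIV_cdivide[OF dM1[OF u(1)]]]])
        (use params uT in \<open>simp add: \<kappa>_def \<nu>_def field_simps\<close>)
    moreover have "(\<epsilon>1 - \<epsilon>2) * p u - (1 + \<epsilon>1) * U u 0 \<ge> - (1 + \<epsilon>1) * c * R u"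
    proof -
      have "0 \<le> (\<epsilon>1 - \<epsilon>2) * p u" using params p[OF uT(1)] by simp
      moreover have "(1 + \<epsilon>1) * U u 0 \<le> (1 + \<epsilon>1) * (c * R u)"
        using params U0_R[OF uT(1)] by (intro mult_left_mono) auto
      ultimately show ?thesis by (simp add: algebra_simps)
    qed
    ultimately show "\<exists>d. (R has_real_derivative d) (at u) \<and> - (1 + \<epsilon>1) * c * R u \<le> d" by blast
  qed (use t in auto)
  moreover have "R 0 > 0" using setpoint M1_eq[of 0] params by (simp add: R_def diff_divide_distrib)
  ultimately have "R t > 0" using mult_pos_pos[OF \<open>R 0 > 0\<close> exp_gt_zero] by (meson order_less_le_trans)
  moreover have "M (Suc 0) t / \<alpha> \<ge> 0" using M_nonneg[of t] U t params by simp
  ultimately have "(sr\<^sup>2 - (s t)\<^sup>2) / (2 * \<beta>) > 0" unfolding R_def by linarith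
  then have "(s t)\<^sup>2 < sr\<^sup>2" using params by (simp add: zero_less_divide_iff)
  then show "s t < sr" by (rule power2_less_imp_less) (use params in simp)
qed

text \<open>Past a time up to which the boundary value is nonnegative, its negative part is at most
  \<open>m\<close>; by the barrier the flux \<open>p\<close> is then at least of order \<open>-m\<close>, and the equation for the
  boundary value gives \<open>m \<le> C \<delta> m\<close> on an interval of length \<open>\<delta>\<close>.\<close>

lemma boundary_nonneg_extends:
  assumes T: "T \<ge> 0" and left: "\<And>t. t \<in> {0..T} \<Longrightarrow> U t 0 \<ge> 0"
  shows "\<exists>\<delta>>0. \<forall>t\<in>{T..T + \<delta>}. U t 0 \<ge> 0"
proof -
  have T_signs: "\<And>y. y \<in> {0..1} \<Longrightarrow> U T y \<ge> 0" "s T < sr"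
    using signs_until[of T T] left T by auto
  have c: "continuous_on {T..T + 1} s" "continuous_on {T..T + 1} (\<lambda>t. \<bar>p t\<bar>)"
    unfolding p_def by (intro continuous_intros continuous_on_subset[OF cont_s] continuous_on_subset[OF cont_Uy1]; use T in auto)+
  have "\<exists>u\<in>{T..T + 1}. \<forall>t\<in>{T..T + 1}. \<bar>p t\<bar> \<le> \<bar>p u\<bar>"
    by (rule continuous_attains_sup[OF _ _ c(2)]) auto
  then obtain tm where tm: "\<And>t. t \<in> {T..T + 1} \<Longrightarrow> \<bar>p t\<bar> \<le> \<bar>p tm\<bar>" by blast
  have "\<exists>u\<in>{T..T + 1}. \<forall>t\<in>{T..T + 1}. s u \<le> s t"
    by (rule continuous_attains_inf[OF _ _ c(1)]) auto
  then obtain ts where ts: "ts \<in> {T..T + 1}" "\<And>t. t \<in> {T..T + 1} \<Longrightarrow> s ts \<le> s t" by blast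
  define \<sigma> where "\<sigma> = s ts"
  have \<sigma>: "\<sigma> > 0" unfolding \<sigma>_def using s_pos ts T by simp
  obtain j :: nat where "\<nu> * \<bar>p tm\<bar> / \<kappa> \<le> real j" using real_arch_simple by blast
  then have "\<nu> * \<bar>p tm\<bar> \<le> \<kappa> * real (Suc j)" using \<kappa>_pos by (simp add: field_simps)
  then have slow: "\<nu> * \<bar>p t\<bar> \<le> \<kappa> * real (Suc j)" if "t \<in> {T..T + 1}" for t
    using mult_left_mono[OF tm[OF that], of \<nu>] \<nu>_pos by linarith
  define n where "n = real (Suc (Suc j))"
  define Bm where "Bm = (1 + \<epsilon>1) * sr"
  \<comment> \<open>A flux of at least \<open>- n * m\<close> lowers the derivative of the boundary
    value by at most \<open>q * m\<close>: \<open>Bm\<close> bounds \<open>B\<close> from above and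
    \<open>\<sigma>\<close> bounds \<open>s\<close> from below.\<close>
  define q where "q = c * n * Bm / \<sigma>"
  have "Bm > 0" "n > 0" using params by (auto simp: Bm_def n_def)
  then have q: "q > 0" using params \<sigma> by (simp add: q_def)
  have "\<exists>\<delta>1>0. \<forall>t\<in>{T..T + 1}. \<bar>t - T\<bar> < \<delta>1 \<longrightarrow> s t < sr"
  proof -
    have "sr - s T > 0" using T_signs(2) by simp
    moreover have "T \<in> {T..T + 1}" by simp
    ultimately obtain d where d: "d > 0" "\<And>t. t \<in> {T..T + 1} \<Longrightarrow> dist t T < d \<Longrightarrow> dist (s t) (s T) < sr - s T"
      using c(1) unfolding continuous_on_iff by blast
    have "s t < sr" if "t \<in> {T..T + 1}" "\<bar>t - T\<bar> < d" for t
      using d(2)[OF that(1)] that(2) by (simp add: dist_real_def)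
    with d(1) show ?thesis by blast
  qed
  then obtain \<delta>1 where \<delta>1: "\<delta>1 > 0" "\<And>t. t \<in> {T..T + 1} \<Longrightarrow> \<bar>t - T\<bar> < \<delta>1 \<Longrightarrow> s t < sr" by blast
  \<comment> \<open>Short enough that \<open>s < sr\<close>, hence \<open>B \<ge> 0\<close>,
    persists and that \<open>q * \<delta> < 1\<close>.\<close>
  define \<delta> where "\<delta> = min (min (\<delta>1 / 2) 1) (1 / (2 * q))"
  have \<delta>: "\<delta> > 0" "\<delta> < \<delta>1" "\<delta> \<le> 1" "q * \<delta> < 1"
  proof -
    show "\<delta> > 0" "\<delta> < \<delta>1" "\<delta> \<le> 1" using \<delta>1 q by (auto simp: \<delta>_def)
    have "q * \<delta> \<le> q * (1 / (2 * q))" using q by (intro mult_left_mono) (auto simp: \<delta>_def)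
    then show "q * \<delta> < 1" using q by simp
  qed
  have "U t 0 \<ge> 0" if t: "t \<in> {T..T + \<delta>}" for t
  proof (rule ccontr)
    assume neg: "\<not> U t 0 \<ge> 0"
    have "continuous_on {T..t} (\<lambda>t. U t 0)"
      by (rule continuous_on_subset[OF cont_U0]) (use T in auto)
    then have "\<exists>u\<in>{T..t}. \<forall>v\<in>{T..t}. U u 0 \<le> U v 0"
      using t by (intro continuous_attains_inf) auto
    then obtain t2 where t2: "t2 \<in> {T..t}" "\<And>u. u \<in> {T..t} \<Longrightarrow> U t2 0 \<le> U u 0" by blast
    define m where "m = - U t2 0"
    have m: "m > 0" using t2(2)[of t] neg t by (auto simp: m_def)
    have flux: "p u \<ge> - (n * m)" if u: "u \<in> {T..t2}" for u
    proof -
      let ?V = "\<lambda>y. U u y + m * (1 - y ^ Suc (Suc j))"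
      have "((\<lambda>y. U u y + m * (1 - y ^ Suc (Suc j))) has_real_derivative Uy u 1 - n * m) (at 1 within {0..1})"
        unfolding n_def using dU_y[of u 1] u T
        by (auto intro!: derivative_eq_intros simp: algebra_simps simp del: power_Suc)
      moreover have "?V 1 = 0" using U1[of u] u T by simp
      moreover have "?V y \<ge> 0" if "y \<in> {0..1}" for y
      proof (rule U_ge_barrier[of T u t2])
        show "U T z \<ge> 0" if "z \<in> {0..1}" for z by (rule T_signs(1)) (rule that)
        show "U w 0 \<ge> - m" if "w \<in> {T..t2}" for w using t2 that by (auto simp: m_def)
        show "\<nu> * \<bar>p w\<bar> \<le> \<kappa> * real (Suc j)" if "w \<in> {T..t2}" for w
          using slow[of w] that t2 t \<delta> by auto
      qed (use T u that m in auto)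
      ultimately have "Uy u 1 - n * m \<le> 0" by (rule deriv_nonpos_at_right_zero)
      then show ?thesis by (simp add: p_def)
    qed
    let ?k = "c * (1 + \<epsilon>1)"
    have k: "?k > 0" using params by simp
    \<comment> \<open>The shift absorbs the source \<open>- (q * m)\<close>, so the homogeneous
      comparison applies with rate \<open>- ?k\<close>.\<close>
    let ?f = "\<lambda>u. U u 0 + q * m / ?k"
    have "?f T * exp (- ?k * (t2 - T)) \<le> ?f t2"
    proof (rule gronwall_ge)
      show "continuous_on {T..t2} ?f"
        by (intro continuous_intros continuous_on_subset[OF cont_U0]) (use T k in auto)
      fix u assume u: "T < u" "u < t2"
      have u': "u \<in> {T..T + 1}" "\<bar>u - T\<bar> < \<delta>1" using u t2 t \<delta> by auto
      have su: "\<sigma> \<le> s u" "s u < sr" using ts(2)[OF u'(1)] \<delta>1(2)[OF u'] by (auto simp: \<sigma>_def)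
      have B: "0 \<le> B u" "B u \<le> Bm"
      proof -
        have "0 \<le> (\<epsilon>1 - \<epsilon>2) * s u" "0 \<le> (1 + \<epsilon>2) * (sr - s u)" using params su \<sigma> by auto
        then show "0 \<le> B u" unfolding B_def by linarith
        have "B u \<le> (\<epsilon>1 - \<epsilon>2) * sr + (1 + \<epsilon>2) * sr"
          unfolding B_def using params su \<sigma> by (intro add_mono mult_left_mono) auto
        then show "B u \<le> Bm" by (simp add: Bm_def algebra_simps)
      qed
      have "- (q * m) \<le> c * p u * B u / s u"
      proof -
        have "B u / s u \<le> Bm / \<sigma>" "0 \<le> B u / s u" using B su \<sigma> by (auto intro!: frac_le)
        have "- (q * m) = - (c * (n * m) * (Bm / \<sigma>))" by (simp add: q_def)
        also have "\<dots> \<le> - (c * (n * m) * (B u / s u))"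
          unfolding neg_le_iff_le using \<open>B u / s u \<le> Bm / \<sigma>\<close> params m \<open>n > 0\<close>
          by (intro mult_left_mono) auto
        also have "\<dots> = c * (- (n * m)) * (B u / s u)" by simp
        also have "\<dots> \<le> c * p u * (B u / s u)"
          using flux[of u] u params \<open>0 \<le> B u / s u\<close> by (intro mult_right_mono mult_left_mono) auto
        finally show ?thesis by simp
      qed
      moreover have "- ?k * ?f u = - c * (1 + \<epsilon>1) * U u 0 - q * m"
      proof -
        have "- z * (U u 0 + q * m / z) = - z * U u 0 - q * m" if "z > 0" for z
          using that by (simp add: field_simps)
        from this[OF k] show ?thesis by (simp only: mult_minus_left)
      qed
      ultimately have "- ?k * ?f u \<le> - c * (1 + \<epsilon>1) * U u 0 + c * p u * B u / s u" by linarith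
      moreover have "(?f has_real_derivative - c * (1 + \<epsilon>1) * U u 0 + c * p u * B u / s u) (at u)"
        using dU0[of u] u T by (auto intro!: derivative_eq_intros)
      ultimately show "\<exists>d. (?f has_real_derivative d) (at u) \<and> - ?k * ?f u \<le> d" by blast
    qed (use t2 in auto)
    \<comment> \<open>Linearising by \<open>exp z \<ge> 1 + z\<close> leads to
      \<open>m \<le> q * m * (t2 - T)\<close>, which is impossible on so short an interval.\<close>
    moreover have "q * m / ?k * (1 - ?k * (t2 - T)) \<le> ?f T * exp (- ?k * (t2 - T))"
    proof -
      have "q * m / ?k * (1 - ?k * (t2 - T)) \<le> q * m / ?k * exp (- ?k * (t2 - T))"
        using exp_ge_add_one_self[of "- ?k * (t2 - T)"] q m k by (intro mult_left_mono) auto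
      also have "\<dots> \<le> ?f T * exp (- ?k * (t2 - T))"
        using left[of T] T by (intro mult_right_mono) auto
      finally show ?thesis .
    qed
    moreover have "q * m / z * (1 - z * (t2 - T)) = q * m / z - q * m * (t2 - T)" if "z > 0" for z
      using that by (simp add: field_simps)
    note this[OF k]
    ultimately have "m \<le> q * m * (t2 - T)" unfolding m_def by linarith
    also have "\<dots> \<le> q * m * \<delta>" using q m t2 t by (intro mult_left_mono) auto
    also have "\<dots> = m * (q * \<delta>)" by simp
    also have "\<dots> < m * 1" using m \<delta> by (intro mult_strict_left_mono) auto
    finally show False by simp
  qed
  with \<delta>(1) show ?thesis by blast
qed

text \<open>Let \<open>T\<close> be the infimum of the times with negative boundary value.
  Continuity from the left, or the initial data if \<open>T = 0\<close>, gives
  \<open>U T 0 \<ge> 0\<close>; nonnegativity then extends beyond \<open>T\<close>, against the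
  choice of \<open>T\<close>.\<close>

lemma boundary_nonneg:
  assumes "t \<ge> 0"
  shows "U t 0 \<ge> 0"
proof (rule ccontr)
  assume neg: "\<not> U t 0 \<ge> 0"
  define S where "S = {u. u \<ge> 0 \<and> U u 0 < 0}"
  define T where "T = Inf S"
  have S: "t \<in> S" "bdd_below S" using neg assms by (auto simp: S_def intro: bdd_belowI[of _ 0])
  have T: "T \<ge> 0" unfolding T_def using S by (intro cInf_greatest) (auto simp: S_def)
  have before: "U u 0 \<ge> 0" if "0 \<le> u" "u < T" for u
  proof (rule ccontr)
    assume "\<not> ?thesis"
    then have "u \<in> S" using that by (simp add: S_def)
    then have "T \<le> u" unfolding T_def using S(2) by (rule cInf_lower)
    with that show False by simp
  qed
  have "U T 0 \<ge> 0"
  proof (cases "T = 0")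
    case False
    then have "T > 0" using T by simp
    have "continuous_on {0<..} (\<lambda>t. U t 0)"
      by (rule continuous_on_subset[OF cont_U0]) auto
    then have "isCont (\<lambda>t. U t 0) T"
      using \<open>T > 0\<close> by (simp add: continuous_on_eq_continuous_at)
    then have "((\<lambda>t. U t 0) \<longlongrightarrow> U T 0) (at_left T)"
      by (simp add: isCont_def filterlim_at_split)
    moreover have "\<forall>\<^sub>F u in at_left T. 0 \<le> U u 0"
      using eventually_at_left_real[OF \<open>T > 0\<close>] by eventually_elim (use before in auto)
    ultimately show ?thesis by (intro tendsto_lowerbound[of _ _ "at_left T"]) auto
  qed (use init[of 0] in auto)
  then have "U u 0 \<ge> 0" if "u \<in> {0..T}" for u
    using before that by (cases "u = T") auto
  from boundary_nonneg_extends[OF T this] obtain \<delta> where \<delta>: "\<delta> > 0" "\<And>u. u \<in> {T..T + \<delta>} \<Longrightarrow> U u 0 \<ge> 0" by blast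
  have "\<exists>u\<in>S. u < T + \<delta>" using cInf_lessD[of S "T + \<delta>"] S \<delta> by (auto simp: T_def)
  then obtain u where u: "u \<in> S" "u < T + \<delta>" by blast
  moreover have "T \<le> u" unfolding T_def using u(1) S(2) by (rule cInf_lower)
  ultimately show False using \<delta>(2)[of u] by (auto simp: S_def)
qed

lemma U_nonneg: "t \<ge> 0 \<Longrightarrow> y \<in> {0..1} \<Longrightarrow> U t y \<ge> 0"
  and p_nonneg: "t \<ge> 0 \<Longrightarrow> p t \<ge> 0"
  and s_less: "t \<ge> 0 \<Longrightarrow> s t < sr"
  using signs_until[of t t] boundary_nonneg by auto

section \<open>Monotone front and moment bounds\<close>

lemma s_mono:
  assumes "0 \<le> t" "t \<le> t'"
  shows "s t \<le> s t'"
proof -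
  have "s t * exp (0 * (t' - t)) \<le> s t'"
  proof (rule gronwall_ge[OF assms(2)])
    show "continuous_on {t..t'} s" using assms by (intro continuous_on_subset[OF cont_s]) auto
    fix u assume "t < u" "u < t'"
    then have "u > 0" using assms by simp
    then show "\<exists>d. (s has_real_derivative d) (at u) \<and> 0 * s u \<le> d"
      using ds'[of u] p_nonneg[of u] s_pos[of u] \<nu>_pos by (intro exI[of _ "\<nu> * p u / s u"]) auto
  qed
  then show ?thesis by simp
qed

lemma M_Suc_le:
  assumes "t \<ge> 0"
  shows "M (Suc k) t \<le> s t * M k t"
proof -
  have "integral {0..1} (\<lambda>y. y ^ Suc k * U t y) \<le> integral {0..1} (\<lambda>y. y ^ k * U t y)"
  proof (rule integral_le)
    fix y :: real assume y: "y \<in> {0..1}"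
    have "y * (y ^ k * U t y) \<le> 1 * (y ^ k * U t y)"
      using y U_nonneg[OF assms y] by (intro mult_right_mono) auto
    then show "y ^ Suc k * U t y \<le> y ^ k * U t y" by (simp add: mult.assoc)
  qed (intro integrable_continuous_interval continuous_intros cont_slice assms)+
  then have "s t ^ Suc (Suc k) * integral {0..1} (\<lambda>y. y ^ Suc k * U t y)
      \<le> s t ^ Suc (Suc k) * integral {0..1} (\<lambda>y. y ^ k * U t y)"
    using s_pos[OF assms] by (intro mult_left_mono) auto
  then show ?thesis by (simp add: M_def mult.assoc)
qed

lemma M_ge0: "t \<ge> 0 \<Longrightarrow> M k t \<ge> 0"
  by (rule M_nonneg) (auto intro: U_nonneg)

text \<open>The control law read backwards: this is the inequality
  \<open>U t 0 \<ge> 0\<close>.\<close>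

lemma M1_upper: "t \<ge> 0 \<Longrightarrow> M (Suc 0) t / \<alpha> \<le> s t * (sr - s t) / \<beta>"
proof -
  assume t: "t \<ge> 0"
  have "U t 0 = c * (s t * (sr - s t) / \<beta> - M (Suc 0) t / \<alpha>)"
    unfolding U0_eq[OF t] by (simp add: algebra_simps diff_divide_distrib)
  with boundary_nonneg[OF t] params show ?thesis by (simp add: zero_le_mult_iff)
qed

lemma U0_upper: "t \<ge> 0 \<Longrightarrow> U t 0 \<le> c * (s t * (sr - s t) / \<beta>)"
proof -
  assume t: "t \<ge> 0"
  have "U t 0 = c * (s t * (sr - s t) / \<beta>) - c * (M (Suc 0) t / \<alpha>)"
    unfolding U0_eq[OF t] by (simp add: algebra_simps diff_divide_distrib)
  moreover have "0 \<le> c * (M (Suc 0) t / \<alpha>)" using M_ge0[OF t] params by simp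
  ultimately show ?thesis by simp
qed

section \<open>Functionals for the front position\<close>

text \<open>The weight \<open>x * (2 * sr - x)\<close> has second derivative \<open>-2\<close>, so
  diffusion produces the damping term \<open>- 2 * M 0 t\<close>, and the flux at the front enters
  \<open>G'\<close> with a negative factor.\<close>

definition G :: "real \<Rightarrow> real" where "G t = 2 * sr * M (Suc 0) t - M (Suc (Suc 0)) t"

text \<open>The coefficient of \<open>G\<close> is such that its boundary term cancels exactly half
  of the \<open>- U t 0\<close> in the derivative, while its damping contributes
  \<open>- M 0 t / (2 * sr)\<close>.\<close>

definition L :: "real \<Rightarrow> real" where
  "L t = (sr\<^sup>2 - (s t)\<^sup>2) / (2 * \<nu>) - M (Suc 0) t / \<kappa> + G t / (4 * \<kappa> * sr)"

text \<open>The terms cancel in pairs: the square of \<open>s\<close> removes the flux produced by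
  the first moment, the third moment supplies the \<open>c * M (Suc 0) t / \<alpha>\<close> that
  turns \<open>U t 0\<close> into a function of \<open>s\<close> alone, and the fourth power removes
  the flux produced by the third moment.\<close>

definition Y :: "real \<Rightarrow> real" where
  "Y t = M (Suc 0) t / \<kappa> + (s t)\<^sup>2 / (2 * \<nu>) + c / (6 * \<kappa> * \<alpha>) * M (Suc (Suc (Suc 0))) t
     + c / (24 * \<alpha> * \<nu>) * s t ^ 4"

definition N :: "real \<Rightarrow> real" where "N t = integral {0..1} (\<lambda>y. (Uy t y)\<^sup>2) / s t"

lemma cont_functionals: "continuous_on {0..} G" "continuous_on {0..} L" "continuous_on {0..} Y"
  "continuous_on {0..} N"
proof -
  show G: "continuous_on {0..} G" unfolding G_def by (intro continuous_intros cont_M)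
  show "continuous_on {0..} L" unfolding L_def
    by (intro continuous_intros cont_M cont_s G) (use params \<kappa>_pos \<nu>_pos in auto)
  show "continuous_on {0..} Y" unfolding Y_def
    by (intro continuous_intros cont_M cont_s) (use params \<kappa>_pos \<nu>_pos in auto)
  have nonzero: "\<forall>t\<in>{0..}. s t \<noteq> 0"
  proof
    fix t :: real assume "t \<in> {0..}"
    then have "0 < s t" using s_pos by simp
    then show "s t \<noteq> 0" by simp
  qed
  have "continuous_on ({0..} \<times> {0..1}) (\<lambda>(t, y). (Uy t y)\<^sup>2)"
    using cont_Uy by (auto simp: case_prod_unfold intro!: continuous_intros)
  then show "continuous_on {0..} N" unfolding N_def
    by (intro continuous_intros cont_s continuous_on_integral_param nonzero)
qed

lemma G_bounds:
  assumes t: "t \<ge> 0"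
  shows "sr * M (Suc 0) t \<le> G t" "G t \<le> 2 * sr * M (Suc 0) t" "G t \<le> 2 * \<alpha> * sr ^ 3 / \<beta>"
    "G t \<le> 2 * sr * (s t * M 0 t)"
proof -
  have st: "0 < s t" "s t < sr" using s_pos s_less t by auto
  have "M (Suc (Suc 0)) t \<le> s t * M (Suc 0) t" by (rule M_Suc_le[OF t])
  also have "\<dots> \<le> sr * M (Suc 0) t" using st M_ge0[OF t] by (intro mult_right_mono) auto
  finally show "sr * M (Suc 0) t \<le> G t" by (simp add: G_def)
  show G2: "G t \<le> 2 * sr * M (Suc 0) t" using M_ge0[OF t] by (simp add: G_def)
  have "M (Suc 0) t / \<alpha> \<le> sr * sr / \<beta>"
    using M1_upper[OF t] st params
    by (elim order_trans) (intro divide_right_mono mult_mono, auto)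
  then have "2 * sr * \<alpha> * (M (Suc 0) t / \<alpha>) \<le> 2 * sr * \<alpha> * (sr * sr / \<beta>)"
    using params by (intro mult_left_mono) auto
  with G2 params show "G t \<le> 2 * \<alpha> * sr ^ 3 / \<beta>" by (simp add: power3_eq_cube mult_ac)
  have "2 * sr * M (Suc 0) t \<le> 2 * sr * (s t * M 0 t)"
    using M_Suc_le[OF t, of 0] params by (intro mult_left_mono) auto
  with G2 show "G t \<le> 2 * sr * (s t * M 0 t)" by simp
qed

lemma dG:
  assumes t: "t > 0"
  shows "(G has_real_derivative \<kappa> * (2 * sr * U t 0 - (2 * sr - s t) * p t - 2 * M 0 t)) (at t)"
  unfolding G_def
  by (rule DERIV_cong[OF DERIV_diff[OF DERIV_cmult[OF dM1[OF t]] dM_Suc[OF t]]]) (simp add: algebra_simps)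

text \<open>Since \<open>G t \<le> 2 * sr * (s t * M 0 t)\<close>, the term
  \<open>- 2 * M 0 t\<close> damps \<open>G\<close> at a rate proportional to
  \<open>1 / s t\<close>: a thin liquid relaxes fast.\<close>

lemma dG_le:
  assumes t: "t > 0"
  shows "\<exists>d. (G has_real_derivative d) (at t) \<and> d \<le> 2 * \<kappa> * sr\<^sup>2 * c / \<beta> * s t - \<kappa> / sr / s t * G t"
proof (intro exI conjI)
  have t0: "t \<ge> 0" using t by simp
  have st: "0 < s t" "s t < sr" using s_pos s_less t0 by auto
  have "U t 0 \<le> c * (s t * sr / \<beta>)"
    using U0_upper[OF t0] st params
    by (elim order_trans) (intro mult_left_mono divide_right_mono, auto)
  then have "2 * sr * U t 0 \<le> 2 * sr * (c * (s t * sr / \<beta>))" using params by (intro mult_left_mono) auto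
  moreover have "0 \<le> (2 * sr - s t) * p t" using st p_nonneg[OF t0] by simp
  moreover have "G t / (sr * s t) \<le> 2 * M 0 t" using G_bounds(4)[OF t0] st params by (simp add: field_simps)
  ultimately have "2 * sr * U t 0 - (2 * sr - s t) * p t - 2 * M 0 t \<le> 2 * sr * (c * (s t * sr / \<beta>)) - G t / (sr * s t)"
    by linarith
  then have "\<kappa> * (2 * sr * U t 0 - (2 * sr - s t) * p t - 2 * M 0 t) \<le> \<kappa> * (2 * sr * (c * (s t * sr / \<beta>)) - G t / (sr * s t))"
    using \<kappa>_pos by (intro mult_left_mono) auto
  also have "\<dots> = 2 * \<kappa> * sr\<^sup>2 * c / \<beta> * s t - \<kappa> / sr / s t * G t"
    by (simp add: field_simps power2_eq_square)
  finally show "\<kappa> * (2 * sr * U t 0 - (2 * sr - s t) * p t - 2 * M 0 t) \<le> 2 * \<kappa> * sr\<^sup>2 * c / \<beta> * s t - \<kappa> / sr / s t * G t" .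
qed (rule dG[OF t])

lemma ds_square: "t > 0 \<Longrightarrow> ((\<lambda>t. (s t)\<^sup>2) has_real_derivative 2 * \<nu> * p t) (at t)"
  by (rule DERIV_cong[OF DERIV_power[OF ds']]) (use s_pos[of t] in \<open>auto simp: field_simps\<close>)

lemma dY:
  assumes t: "t > 0"
  shows "(Y has_real_derivative c / \<beta> * s t * (sr - s t)) (at t)"
proof -
  have st: "0 < s t" using s_pos t by simp
  note nz = params \<kappa>_pos \<nu>_pos st
  have s4: "((\<lambda>t. s t ^ 4) has_real_derivative 4 * \<nu> * (s t)\<^sup>2 * p t) (at t)"
    by (rule DERIV_cong[OF DERIV_power[OF ds'[OF t]]]) (use st in \<open>auto simp: field_simps power2_eq_square power3_eq_cube\<close>)
  have "(Y has_real_derivative \<kappa> * (U t 0 - p t) / \<kappa> + 2 * \<nu> * p t / (2 * \<nu>)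
      + c / (6 * \<kappa> * \<alpha>) * (- \<kappa> * s t ^ Suc (Suc 0) * p t + \<kappa> * real (Suc (Suc (Suc 0))) * real (Suc (Suc 0)) * M (Suc 0) t)
      + c / (24 * \<alpha> * \<nu>) * (4 * \<nu> * (s t)\<^sup>2 * p t)) (at t)"
    unfolding Y_def
    by (intro DERIV_add DERIV_cmult DERIV_cdivide dM1[OF t] dM_Suc[OF t] ds_square[OF t] s4)
  moreover have "\<kappa> * (U t 0 - p t) / \<kappa> + 2 * \<nu> * p t / (2 * \<nu>)
      + c / (6 * \<kappa> * \<alpha>) * (- \<kappa> * s t ^ Suc (Suc 0) * p t + \<kappa> * real (Suc (Suc (Suc 0))) * real (Suc (Suc 0)) * M (Suc 0) t)
      + c / (24 * \<alpha> * \<nu>) * (4 * \<nu> * (s t)\<^sup>2 * p t) = U t 0 + c * M (Suc 0) t / \<alpha>"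
    using nz by (simp add: field_simps power2_eq_square)
  moreover have "U t 0 + c * M (Suc 0) t / \<alpha> = c / \<beta> * s t * (sr - s t)"
    using U0_eq[of t] t nz by (simp add: field_simps)
  ultimately show ?thesis by simp
qed

lemma Y_pos:
  assumes t: "t \<ge> 0"
  shows "Y t > 0"
proof -
  have st: "0 < s t" using s_pos t by simp
  note nz = params \<kappa>_pos \<nu>_pos st
  show ?thesis unfolding Y_def using nz M_ge0[OF t]
    by (intro add_pos_nonneg add_nonneg_pos) auto
qed

lemma Y_upper:
  assumes t: "t \<ge> 0"
  shows "Y t \<le> (1 / (\<kappa> * sr) + c * sr / (6 * \<kappa> * \<alpha>) + 1 / (2 * \<nu>) + c * sr\<^sup>2 / (24 * \<alpha> * \<nu>)) * ((s t)\<^sup>2 + G t)"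
proof -
  have st: "0 < s t" "s t < sr" using s_pos s_less t by auto
  note nz = params \<kappa>_pos \<nu>_pos st
  have M1: "0 \<le> M (Suc 0) t" "M (Suc 0) t \<le> G t / sr" using G_bounds(1)[OF t] M_ge0[OF t] nz by (auto simp: field_simps)
  have G0: "0 \<le> G t" using order_trans[OF mult_nonneg_nonneg G_bounds(1)[OF t]] M1 nz by simp
  have "M (Suc (Suc (Suc 0))) t \<le> s t * M (Suc (Suc 0)) t" by (rule M_Suc_le[OF t])
  also have "\<dots> \<le> s t * (s t * M (Suc 0) t)" using M_Suc_le[OF t] nz by (intro mult_left_mono) auto
  also have "\<dots> \<le> sr * (sr * (G t / sr))" using M1 nz by (intro mult_mono) auto
  finally have M3: "M (Suc (Suc (Suc 0))) t \<le> sr * G t" using nz by simp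
  have s4: "s t ^ 4 \<le> sr\<^sup>2 * (s t)\<^sup>2"
  proof -
    have "(s t)\<^sup>2 * (s t)\<^sup>2 \<le> sr\<^sup>2 * (s t)\<^sup>2" using nz by (intro mult_right_mono power_mono) auto
    then show ?thesis by (simp add: power2_eq_square power4_eq_xxxx mult.assoc)
  qed
  have "Y t \<le> G t / sr / \<kappa> + (s t)\<^sup>2 / (2 * \<nu>) + c / (6 * \<kappa> * \<alpha>) * (sr * G t) + c / (24 * \<alpha> * \<nu>) * (sr\<^sup>2 * (s t)\<^sup>2)"
    unfolding Y_def using M1 M3 s4 nz by (intro add_mono mult_left_mono divide_right_mono) auto
  also have "\<dots> = (1 / (\<kappa> * sr) + c * sr / (6 * \<kappa> * \<alpha>)) * G t + (1 / (2 * \<nu>) + c * sr\<^sup>2 / (24 * \<alpha> * \<nu>)) * (s t)\<^sup>2"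
    by (simp add: algebra_simps)
  also have "\<dots> \<le> (1 / (\<kappa> * sr) + c * sr / (6 * \<kappa> * \<alpha>)) * ((s t)\<^sup>2 + G t) + (1 / (2 * \<nu>) + c * sr\<^sup>2 / (24 * \<alpha> * \<nu>)) * ((s t)\<^sup>2 + G t)"
    using nz G0 by (intro add_mono mult_left_mono) auto
  finally show ?thesis by (simp add: distrib_right)
qed

text \<open>The part \<open>P\<close> without \<open>G\<close> is nonnegative by the bound on the
  first moment and \<open>\<epsilon>1 \<ge> \<epsilon>2\<close>, but this alone gives only a bound
  quadratic in \<open>sr - s t\<close>. The \<open>G\<close> term adds a quarter of
  \<open>M (Suc 0) t / \<kappa>\<close>, so \<open>4 * L t\<close> dominates
  \<open>P + M (Suc 0) t / \<kappa>\<close>, which is linear in \<open>sr - s t\<close> up to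
  constants.\<close>

lemma L_bounds:
  assumes t: "t \<ge> 0"
  shows "0 \<le> L t" "sr - s t \<le> 8 * \<nu> / sr * L t" "L t \<le> sr / \<nu> * (sr - s t)"
proof -
  have st: "0 < s t" "s t < sr" using s_pos s_less t by auto
  note nz = params \<kappa>_pos \<nu>_pos st
  have M1: "0 \<le> M (Suc 0) t" by (rule M_ge0[OF t])
  have "M (Suc 0) t / \<kappa> = M (Suc 0) t / \<alpha> / (1 + \<epsilon>1)" by (simp add: \<kappa>_def)
  also have "\<dots> \<le> s t * (sr - s t) / \<beta> / (1 + \<epsilon>1)"
    using M1_upper[OF t] nz by (intro divide_right_mono) auto
  also have "\<dots> \<le> s t * (sr - s t) / \<beta> / (1 + \<epsilon>2)"
    using nz by (intro divide_left_mono) auto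
  finally have M1k: "M (Suc 0) t / \<kappa> \<le> s t * (sr - s t) / \<nu>" by (simp add: \<nu>_def)
  define P where "P = (sr\<^sup>2 - (s t)\<^sup>2) / (2 * \<nu>) - M (Suc 0) t / \<kappa>"
  have "0 \<le> (sr - s t)\<^sup>2 / (2 * \<nu>)" using nz by simp
  also have "\<dots> = (sr\<^sup>2 - (s t)\<^sup>2) / (2 * \<nu>) - s t * (sr - s t) / \<nu>"
    using nz by (simp add: field_simps power2_eq_square)
  also have "\<dots> \<le> P" unfolding P_def using M1k by simp
  finally have P: "0 \<le> P" .
  have "sr * M (Suc 0) t / (4 * \<kappa> * sr) \<le> G t / (4 * \<kappa> * sr)"
    using G_bounds(1)[OF t] nz by (intro divide_right_mono) auto
  then have G: "1 / 4 * (M (Suc 0) t / \<kappa>) \<le> G t / (4 * \<kappa> * sr)" using nz by (simp add: field_simps)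
  have LP: "L t = P + G t / (4 * \<kappa> * sr)" by (simp add: L_def P_def)
  have "0 \<le> M (Suc 0) t / \<kappa>" using M1 nz by simp
  with LP P G show "0 \<le> L t" by linarith
  have "(sr\<^sup>2 - (s t)\<^sup>2) / (2 * \<nu>) = P + M (Suc 0) t / \<kappa>" by (simp add: P_def)
  also have "\<dots> \<le> 4 * L t" using LP P G by linarith
  finally have "(sr\<^sup>2 - (s t)\<^sup>2) / (2 * \<nu>) \<le> 4 * L t" .
  moreover have "(sr - s t) * sr / (2 * \<nu>) \<le> (sr\<^sup>2 - (s t)\<^sup>2) / (2 * \<nu>)"
  proof (rule divide_right_mono)
    have "0 \<le> (sr - s t) * s t" using nz by simp
    then show "(sr - s t) * sr \<le> sr\<^sup>2 - (s t)\<^sup>2" by (simp add: power2_eq_square algebra_simps)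
  qed (use nz in auto)
  ultimately have "(sr - s t) * sr / (2 * \<nu>) \<le> 4 * L t" by linarith
  then show "sr - s t \<le> 8 * \<nu> / sr * L t" using nz by (simp add: field_simps)
  have "G t / (4 * \<kappa> * sr) \<le> 2 * sr * M (Suc 0) t / (4 * \<kappa> * sr)"
    using G_bounds(2)[OF t] nz by (intro divide_right_mono) auto
  also have "\<dots> = 1 / 2 * (M (Suc 0) t / \<kappa>)" using nz by simp
  also have "\<dots> \<le> M (Suc 0) t / \<kappa>" using \<open>0 \<le> M (Suc 0) t / \<kappa>\<close> by linarith
  finally have "L t \<le> (sr\<^sup>2 - (s t)\<^sup>2) / (2 * \<nu>)" by (simp add: L_def)
  also have "\<dots> \<le> 2 * sr * (sr - s t) / (2 * \<nu>)"
  proof (rule divide_right_mono)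
    have "0 \<le> (sr - s t)\<^sup>2" by simp
    then show "sr\<^sup>2 - (s t)\<^sup>2 \<le> 2 * sr * (sr - s t)" by (simp add: power2_eq_square algebra_simps)
  qed (use nz in auto)
  also have "\<dots> = sr / \<nu> * (sr - s t)" by simp
  finally show "L t \<le> sr / \<nu> * (sr - s t)" .
qed

text \<open>Through the control law, \<open>- (U t 0 / 2)\<close> is the wanted damping in
  \<open>s t * (sr - s t)\<close> plus a moment of the wrong sign. For a small gain that moment is
  absorbed by \<open>- M 0 t / (2 * sr)\<close>.\<close>

lemma dL_le:
  assumes t: "t > 0" and small: "6 * c * sr\<^sup>2 \<le> \<alpha>"
  shows "\<exists>d. (L has_real_derivative d) (at t) \<and> d \<le> - (c * (1 + \<epsilon>2) / (2 * sr)) * s t * L t"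
proof (intro exI conjI)
  have t0: "t \<ge> 0" using t by simp
  have st: "0 < s t" "s t < sr" using s_pos s_less t0 by auto
  note nz = params \<kappa>_pos \<nu>_pos st
  let ?d = "(0 - 2 * \<nu> * p t) / (2 * \<nu>) - \<kappa> * (U t 0 - p t) / \<kappa>
      + \<kappa> * (2 * sr * U t 0 - (2 * sr - s t) * p t - 2 * M 0 t) / (4 * \<kappa> * sr)"
  show "(L has_real_derivative ?d) (at t)"
    unfolding L_def
    by (intro DERIV_add DERIV_diff DERIV_cdivide DERIV_const ds_square t dM1 dG)
  have "?d = - (U t 0 / 2) - (2 * sr - s t) * p t / (4 * sr) - M 0 t / (2 * sr)"
    using nz by (simp add: field_simps)
  also have "\<dots> \<le> - (U t 0 / 2) - M 0 t / (2 * sr)"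
    using nz p_nonneg[OF t0] by simp
  also have "U t 0 / 2 = c * s t * (sr - s t) / (2 * \<beta>) - c / (2 * \<alpha>) * M (Suc 0) t"
    using U0_eq[OF t0] nz by (simp add: field_simps)
  also have "- (c * s t * (sr - s t) / (2 * \<beta>) - c / (2 * \<alpha>) * M (Suc 0) t) - M 0 t / (2 * sr)
      \<le> - (c * s t * (sr - s t) / (2 * \<beta>))"
  proof -
    have "M (Suc 0) t \<le> sr * M 0 t"
      using M_Suc_le[OF t0, of 0] mult_right_mono[of "s t" sr "M 0 t"] st M_ge0[OF t0, of 0] by linarith
    then have "c / (2 * \<alpha>) * M (Suc 0) t \<le> c / (2 * \<alpha>) * (sr * M 0 t)"
      using nz by (intro mult_left_mono) auto
    also have "\<dots> = (c * sr\<^sup>2 / \<alpha>) * (M 0 t / (2 * sr))" using nz by (simp add: field_simps power2_eq_square)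
    also have "\<dots> \<le> 1 * (M 0 t / (2 * sr))"
    proof (rule mult_right_mono)
      have "c * sr\<^sup>2 \<ge> 0" using nz by simp
      with small nz show "c * sr\<^sup>2 / \<alpha> \<le> 1" by simp
    qed (use nz M_ge0[OF t0] in auto)
    finally show ?thesis by simp
  qed
  also have "\<dots> \<le> - (c * (1 + \<epsilon>2) / (2 * sr)) * s t * L t"
  proof -
    have "(c * (1 + \<epsilon>2) / (2 * sr)) * s t * L t \<le> (c * (1 + \<epsilon>2) / (2 * sr)) * s t * (sr / \<nu> * (sr - s t))"
      using L_bounds(3)[OF t0] nz by (intro mult_left_mono) auto
    also have "\<dots> = c * s t * (sr - s t) / (2 * \<beta>)" using nz by (simp add: \<nu>_def)
    finally show ?thesis by simp
  qed
  finally show "?d \<le> - (c * (1 + \<epsilon>2) / (2 * sr)) * s t * L t" .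
qed

section \<open>Energy estimate for the gradient\<close>

lemma N_nonneg: "t \<ge> 0 \<Longrightarrow> N t \<ge> 0"
  unfolding N_def using s_pos[of t]
  by (intro divide_nonneg_pos integral_nonneg integrable_continuous_interval continuous_intros cont_slice) auto

text \<open>By the mean value theorem and \<open>U t 1 = 0\<close>, \<open>Uy\<close> takes the
  value \<open>- U t 0\<close> somewhere; elsewhere it differs by at most the oscillation that
  \<open>Uyy\<close> allows.\<close>

lemma Uy_square_le:
  assumes t: "t > 0" and z: "z \<in> {0..1}"
  shows "(Uy t z)\<^sup>2 \<le> 2 * (U t 0)\<^sup>2 + 2 * integral {0..1} (\<lambda>y. (Uyy t y)\<^sup>2)"
proof -
  have der: "(U t has_real_derivative Uy t y) (at y)" if "0 < y" "y < 1" for y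
    using dU_y[of t y] t that at_within_Icc_at[of 0 y 1] by simp
  have "\<exists>l y. 0 < y \<and> y < 1 \<and> (U t has_real_derivative l) (at y) \<and> U t 1 - U t 0 = (1 - 0) * l"
  proof (rule MVT)
    show "continuous_on {0..1} (U t)" using t by (intro cont_slice) simp
    show "U t differentiable at y" if "0 < y" "y < 1" for y
      using der[OF that] real_differentiable_def by blast
  qed simp
  then obtain l y where y: "0 < y" "y < 1" "(U t has_real_derivative l) (at y)" "U t 1 - U t 0 = (1 - 0) * l" by blast
  have "l = Uy t y" using DERIV_unique[OF y(3) der[OF y(1,2)]] .
  with y(4) U1[of t] t have Uy: "Uy t y = - U t 0" by simp
  have "(Uy t z - Uy t y)\<^sup>2 \<le> integral {0..1} (\<lambda>y. (Uyy t y)\<^sup>2)"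
    by (rule square_increment_le[OF dU_yy[OF t] cont_slice(3)[OF t]]) (use y z in auto)
  moreover have "(Uy t z)\<^sup>2 \<le> 2 * (Uy t y)\<^sup>2 + 2 * (Uy t z - Uy t y)\<^sup>2"
  proof -
    have "0 \<le> (Uy t z - 2 * Uy t y)\<^sup>2" by simp
    then show ?thesis by (simp add: power2_eq_square algebra_simps)
  qed
  ultimately show ?thesis unfolding Uy by simp
qed

lemma integral_Uy_square_le:
  assumes t: "t > 0"
  shows "integral {0..1} (\<lambda>y. (Uy t y)\<^sup>2) \<le> 2 * (U t 0)\<^sup>2 + 2 * integral {0..1} (\<lambda>y. (Uyy t y)\<^sup>2)"
proof -
  have "integral {0..1} (\<lambda>y. (Uy t y)\<^sup>2)
      \<le> integral {0..1} (\<lambda>y::real. 2 * (U t 0)\<^sup>2 + 2 * integral {0..1} (\<lambda>y. (Uyy t y)\<^sup>2))"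
    by (intro integral_le integrable_continuous_interval continuous_intros cont_slice Uy_square_le)
      (use t in auto)
  then show ?thesis by simp
qed

lemma Ut_boundary:
  assumes t: "t > 0"
  shows "Ut t 1 = 0" "Ut t 0 = - c * (1 + \<epsilon>1) * U t 0 + c * p t * B t / s t"
proof -
  have "((\<lambda>_. 0) has_real_derivative Ut t 1) (at t)"
    by (rule has_field_derivative_transform_within_open[OF dU_t[OF t], of _ "{0<..}"]) (use t U1 in auto)
  then show "Ut t 1 = 0" using DERIV_const DERIV_unique by blast
  show "Ut t 0 = - c * (1 + \<epsilon>1) * U t 0 + c * p t * B t / s t"
    by (rule DERIV_unique[OF dU_t[OF t] dU0[OF t]]) simp
qed

text \<open>In the drift term, \<open>2 * y * Uy * Uyy\<close> is \<open>y\<close> times the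
  derivative of the squared gradient, so one integration by parts leaves only the flux and the
  energy.\<close>

lemma integral_Ut_Uyy:
  assumes t: "t > 0"
  shows "integral {0..1} (\<lambda>y. Ut t y * Uyy t y) =
    (\<kappa> * integral {0..1} (\<lambda>y. (Uyy t y)\<^sup>2)
      + \<nu> * p t * ((p t)\<^sup>2 / 2 - integral {0..1} (\<lambda>y. (Uy t y)\<^sup>2) / 2)) / (s t)\<^sup>2"
proof -
  have t0: "t \<ge> 0" using t by simp
  let ?E = "integral {0..1} (\<lambda>y. (Uy t y)\<^sup>2)" and ?W = "integral {0..1} (\<lambda>y. (Uyy t y)\<^sup>2)"
  have E: "((\<lambda>y. (Uy t y)\<^sup>2) has_integral ?E) {0..1}" and W: "((\<lambda>y. (Uyy t y)\<^sup>2) has_integral ?W) {0..1}"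
    using cont_slice(2)[OF t0] cont_slice(3)[OF t]
    by (auto intro!: integrable_integral integrable_continuous_interval continuous_intros)
  have "((\<lambda>y. (Uy t y)\<^sup>2 + y * (2 * Uy t y * Uyy t y)) has_integral 1 * (Uy t 1)\<^sup>2 - 0 * (Uy t 0)\<^sup>2) {0..1}"
  proof (rule fundamental_theorem_of_calculus)
    fix y :: real assume y: "y \<in> {0..1}"
    show "((\<lambda>y. y * (Uy t y)\<^sup>2) has_vector_derivative (Uy t y)\<^sup>2 + y * (2 * Uy t y * Uyy t y)) (at y within {0..1})"
      unfolding has_real_derivative_iff_has_vector_derivative[symmetric]
      by (rule DERIV_cong[OF DERIV_mult[OF DERIV_ident DERIV_power[OF dU_yy[OF t y]]]]) simp
  qed simp
  from has_integral_diff[OF this E]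
  have "((\<lambda>y. y * (2 * Uy t y * Uyy t y)) has_integral (p t)\<^sup>2 - ?E) {0..1}" by (simp add: p_def)
  from has_integral_add[OF has_integral_mult_right[OF W, of "\<kappa> / (s t)\<^sup>2"]
      has_integral_mult_right[OF this, of "\<nu> * p t / (2 * (s t)\<^sup>2)"]]
  have "((\<lambda>y. Ut t y * Uyy t y) has_integral
     \<kappa> / (s t)\<^sup>2 * ?W + \<nu> * p t / (2 * (s t)\<^sup>2) * ((p t)\<^sup>2 - ?E)) {0..1}"
  proof (rule has_integral_eq[rotated])
    fix y :: real assume y: "y \<in> {0..1}"
    show "\<kappa> / (s t)\<^sup>2 * (Uyy t y)\<^sup>2 + \<nu> * p t / (2 * (s t)\<^sup>2) * (y * (2 * Uy t y * Uyy t y)) = Ut t y * Uyy t y"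
      unfolding pde[OF t y] p_def using s_pos[OF t0] by (simp add: field_simps power2_eq_square)
  qed
  from integral_unique[OF this] show ?thesis by (simp add: add_divide_distrib diff_divide_distrib algebra_simps)
qed

text \<open>The energy produced by the drift cancels the derivative of the factor
  \<open>1 / s t\<close>. Of the motion of the front only the cubic flux term remains, which has the
  good sign because \<open>p t \<ge> 0\<close>.\<close>

lemma dN:
  assumes t: "t > 0"
  shows "(N has_real_derivative - 2 * Ut t 0 * Uy t 0 / s t
    - 2 * \<kappa> * integral {0..1} (\<lambda>y. (Uyy t y)\<^sup>2) / s t ^ 3 - \<nu> * p t ^ 3 / s t ^ 3) (at t)"
proof -
  have st: "s t > 0" using s_pos t by simp
  let ?W = "integral {0..1} (\<lambda>y. (Uyy t y)\<^sup>2)" and ?E = "integral {0..1} (\<lambda>y. (Uy t y)\<^sup>2)"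
  have "continuous_on ({0<..} \<times> {0..1}) (\<lambda>(t, y). Uy t y)"
    by (rule continuous_on_subset[OF cont_Uy]) auto
  from has_derivative_energy[OF this cont_Uyy cont_Ut, of U t]
  have dE: "((\<lambda>t. integral {0..1} (\<lambda>y. (Uy t y)\<^sup>2)) has_real_derivative
     2 * (Ut t 1 * Uy t 1 - Ut t 0 * Uy t 0 - integral {0..1} (\<lambda>y. Ut t y * Uyy t y))) (at t)"
    using dU_y dU_yy dU_t t by simp
  show ?thesis
    unfolding N_def[abs_def]
  proof (rule DERIV_cong[OF DERIV_divide[OF dE ds'[OF t]]])
    show "s t \<noteq> 0" using st by simp
    show "(2 * (Ut t 1 * Uy t 1 - Ut t 0 * Uy t 0 - integral {0..1} (\<lambda>y. Ut t y * Uyy t y)) * s t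
          - ?E * (\<nu> * p t / s t)) / (s t * s t)
       = - 2 * Ut t 0 * Uy t 0 / s t - 2 * \<kappa> * ?W / s t ^ 3 - \<nu> * p t ^ 3 / s t ^ 3"
      unfolding integral_Ut_Uyy[OF t] Ut_boundary(1)[OF t] using st
      by (simp add: field_simps power2_eq_square power3_eq_cube)
  qed
qed

lemma boundary_work_le:
  assumes t: "t > 0"
  shows "- 2 * Ut t 0 * Uy t 0 \<le> c * (1 + \<epsilon>1) * (sr / s t) *
      (7 * (U t 0)\<^sup>2 + 6 * integral {0..1} (\<lambda>y. (Uyy t y)\<^sup>2))"
proof -
  have t0: "t \<ge> 0" using t by simp
  have st: "0 < s t" "s t < sr" using s_pos s_less t0 by auto
  note nz = params st
  let ?W = "integral {0..1} (\<lambda>y. (Uyy t y)\<^sup>2)"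
  let ?z = "\<bar>Uy t 0\<bar>" and ?r = "sr / s t" and ?u = "U t 0"
  have u: "?u \<ge> 0" and p: "p t \<ge> 0" using boundary_nonneg p_nonneg t0 by auto
  have z2: "?z\<^sup>2 \<le> 2 * ?u\<^sup>2 + 2 * ?W" and p2: "(p t)\<^sup>2 \<le> 2 * ?u\<^sup>2 + 2 * ?W"
    using Uy_square_le[OF t, of 0] Uy_square_le[OF t, of 1] by (auto simp: p_def)
  have r: "1 \<le> ?r" using nz by simp
  have B: "0 \<le> B t" "B t \<le> (1 + \<epsilon>1) * sr"
  proof -
    have "0 \<le> (\<epsilon>1 - \<epsilon>2) * s t" "0 \<le> (1 + \<epsilon>2) * (sr - s t)" using nz by auto
    then show "0 \<le> B t" unfolding B_def by linarith
    have "(\<epsilon>1 - \<epsilon>2) * s t \<le> (\<epsilon>1 - \<epsilon>2) * sr" "(1 + \<epsilon>2) * (sr - s t) \<le> (1 + \<epsilon>2) * sr"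
      using nz by (auto intro: mult_left_mono)
    then show "B t \<le> (1 + \<epsilon>1) * sr" by (simp add: B_def algebra_simps)
  qed
  have "\<bar>Ut t 0\<bar> \<le> c * (1 + \<epsilon>1) * ?u + c * p t * B t / s t"
    unfolding Ut_boundary(2)[OF t] using nz u p B by (simp add: abs_le_iff)
  also have "c * p t * B t / s t \<le> c * p t * ((1 + \<epsilon>1) * sr) / s t"
    using nz p B by (intro divide_right_mono mult_left_mono) auto
  finally have Ut: "\<bar>Ut t 0\<bar> \<le> c * (1 + \<epsilon>1) * (?u + ?r * p t)" by (simp add: algebra_simps)
  have "- 2 * Ut t 0 * Uy t 0 \<le> 2 * (\<bar>Ut t 0\<bar> * ?z)"
  proof -
    have "- (Ut t 0 * Uy t 0) \<le> \<bar>Ut t 0 * Uy t 0\<bar>" by (rule abs_ge_minus_self)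
    then show ?thesis by (simp add: abs_mult)
  qed
  also have "\<dots> \<le> 2 * (c * (1 + \<epsilon>1) * (?u + ?r * p t) * ?z)"
    using mult_right_mono[OF Ut, of ?z] by simp
  also have "\<dots> = c * (1 + \<epsilon>1) * (2 * ?u * ?z + ?r * (2 * p t * ?z))" by (simp add: algebra_simps)
  also have "\<dots> \<le> c * (1 + \<epsilon>1) * (?r * (7 * ?u\<^sup>2 + 6 * ?W))"
  proof (rule mult_left_mono)
    have uz: "2 * ?u * ?z \<le> ?u\<^sup>2 + ?z\<^sup>2" and pz: "2 * p t * ?z \<le> (p t)\<^sup>2 + ?z\<^sup>2"
      using sum_squares_bound[of ?u ?z] sum_squares_bound[of "p t" ?z] by auto
    have "2 * ?u * ?z \<le> 1 * (?u\<^sup>2 + ?z\<^sup>2)" using uz by simp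
    also have "\<dots> \<le> ?r * (?u\<^sup>2 + ?z\<^sup>2)" using r by (intro mult_right_mono) auto
    finally have "2 * ?u * ?z + ?r * (2 * p t * ?z) \<le> ?r * (?u\<^sup>2 + ?z\<^sup>2) + ?r * ((p t)\<^sup>2 + ?z\<^sup>2)"
      using r pz by (intro add_mono mult_left_mono) auto
    also have "\<dots> = ?r * (?u\<^sup>2 + ?z\<^sup>2 + (p t)\<^sup>2 + ?z\<^sup>2)" by (simp add: algebra_simps)
    \<comment> \<open>Three squared gradients, each at most \<open>2 * ?u\<^sup>2 + 2 * ?W\<close>,
      explain the constants \<open>7 = 1 + 6\<close> and \<open>6\<close>.\<close>
    also have "\<dots> \<le> ?r * (7 * ?u\<^sup>2 + 6 * ?W)"
      using z2 p2 r by (intro mult_left_mono) auto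
    finally show "2 * ?u * ?z + ?r * (2 * p t * ?z) \<le> ?r * (7 * ?u\<^sup>2 + 6 * ?W)" .
  qed (use nz in auto)
  finally show ?thesis by (simp add: mult.assoc)
qed

text \<open>The dissipation contains two copies of
  \<open>\<kappa> / sr * (?W / (s t)\<^sup>2)\<close>. One absorbs the boundary work, by the
  smallness of \<open>c\<close>; the other controls \<open>N\<close> up to the boundary value, and
  \<open>U t 0 / s t\<close> is bounded by a multiple of \<open>L t\<close>.\<close>

lemma dN_le:
  assumes t: "t > 0" and small: "6 * c * sr\<^sup>2 \<le> \<alpha>"
  shows "\<exists>d. (N has_real_derivative d) (at t) \<and>
    d \<le> - (\<kappa> / (2 * sr\<^sup>2)) * N t + (7 * c * (1 + \<epsilon>1) * sr + \<kappa> / sr) * (c / \<beta> * (8 * \<nu> / sr))\<^sup>2 * (L t)\<^sup>2"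
proof (intro exI conjI, rule dN[OF t])
  have t0: "t \<ge> 0" using t by simp
  have st: "0 < s t" "s t < sr" using s_pos s_less t0 by auto
  note nz = params \<kappa>_pos \<nu>_pos st
  let ?W = "integral {0..1} (\<lambda>y. (Uyy t y)\<^sup>2)" and ?u = "U t 0"
  let ?e = "c * (1 + \<epsilon>1)"
  have W: "?W \<ge> 0"
    by (intro integral_nonneg integrable_continuous_interval continuous_intros cont_slice) (use t in auto)
  have "- 2 * Ut t 0 * Uy t 0 / s t \<le> ?e * (sr / s t) * (7 * ?u\<^sup>2 + 6 * ?W) / s t"
    using boundary_work_le[OF t] st by (intro divide_right_mono) auto
  also have "\<dots> = 7 * ?e * sr * (?u / s t)\<^sup>2 + 6 * ?e * sr * (?W / (s t)\<^sup>2)"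
    by (simp add: algebra_simps add_divide_distrib power2_eq_square)
  finally have work: "- 2 * Ut t 0 * Uy t 0 / s t \<le> 7 * ?e * sr * (?u / s t)\<^sup>2 + 6 * ?e * sr * (?W / (s t)\<^sup>2)" .
  have "6 * c * sr\<^sup>2 * (1 + \<epsilon>1) \<le> \<alpha> * (1 + \<epsilon>1)" using small nz by (intro mult_right_mono) auto
  then have "6 * ?e * sr \<le> \<kappa> / sr" using nz by (simp add: \<kappa>_def field_simps power2_eq_square)
  then have "6 * ?e * sr * (?W / (s t)\<^sup>2) \<le> \<kappa> / sr * (?W / (s t)\<^sup>2)"
    using W by (intro mult_right_mono) auto
  moreover have "2 * (\<kappa> / sr * (?W / (s t)\<^sup>2)) \<le> 2 * \<kappa> * ?W / s t ^ 3"
  proof -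
    have "?W * s t \<le> ?W * sr" using st W by (intro mult_left_mono) auto
    then show ?thesis using nz by (simp add: field_simps power2_eq_square power3_eq_cube)
  qed
  moreover have "0 \<le> \<nu> * p t ^ 3 / s t ^ 3" using nz p_nonneg[OF t0] by simp
  moreover have "\<kappa> / (2 * sr\<^sup>2) * N t - \<kappa> / sr * (?u / s t)\<^sup>2 \<le> \<kappa> / sr * (?W / (s t)\<^sup>2)"
  proof -
    have "N t * s t \<le> 2 * ?u\<^sup>2 + 2 * ?W"
      using integral_Uy_square_le[OF t] nz by (simp add: N_def)
    then have "N t * s t / (2 * (s t)\<^sup>2) \<le> (2 * ?u\<^sup>2 + 2 * ?W) / (2 * (s t)\<^sup>2)"
      by (intro divide_right_mono) auto
    then have "N t / (2 * s t) \<le> (?u / s t)\<^sup>2 + ?W / (s t)\<^sup>2"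
      using st by (simp add: field_simps power2_eq_square)
    moreover have "N t / (2 * sr) \<le> N t / (2 * s t)"
      using st N_nonneg[OF t0] by (intro divide_left_mono) auto
    ultimately have "\<kappa> / sr * (N t / (2 * sr)) \<le> \<kappa> / sr * ((?u / s t)\<^sup>2 + ?W / (s t)\<^sup>2)"
      using nz by (intro mult_left_mono) auto
    then show ?thesis using nz by (simp add: algebra_simps power2_eq_square)
  qed
  ultimately have main: "- 2 * Ut t 0 * Uy t 0 / s t - 2 * \<kappa> * ?W / s t ^ 3 - \<nu> * p t ^ 3 / s t ^ 3
      \<le> - (\<kappa> / (2 * sr\<^sup>2)) * N t + (7 * ?e * sr + \<kappa> / sr) * (?u / s t)\<^sup>2"
    unfolding distrib_right using work by linarith
  have "(?u / s t)\<^sup>2 \<le> (c / \<beta> * (8 * \<nu> / sr * L t))\<^sup>2"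
  proof (rule power_mono)
    have "?u / s t \<le> c * (s t * (sr - s t) / \<beta>) / s t"
      using U0_upper[OF t0] st by (intro divide_right_mono) auto
    also have "\<dots> = c / \<beta> * (sr - s t)" using nz by simp
    also have "\<dots> \<le> c / \<beta> * (8 * \<nu> / sr * L t)" using L_bounds(2)[OF t0] nz by (intro mult_left_mono) auto
    finally show "?u / s t \<le> c / \<beta> * (8 * \<nu> / sr * L t)" .
    show "0 \<le> ?u / s t" using boundary_nonneg[OF t0] st by simp
  qed
  then have "(7 * ?e * sr + \<kappa> / sr) * (?u / s t)\<^sup>2 \<le> (7 * ?e * sr + \<kappa> / sr) * (c / \<beta> * (8 * \<nu> / sr * L t))\<^sup>2"
    using nz by (intro mult_left_mono) auto
  also have "\<dots> = (7 * c * (1 + \<epsilon>1) * sr + \<kappa> / sr) * (c / \<beta> * (8 * \<nu> / sr))\<^sup>2 * (L t)\<^sup>2"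
    by (simp only: power2_eq_square mult_ac)
  finally show "- 2 * Ut t 0 * Uy t 0 / s t - 2 * \<kappa> * ?W / s t ^ 3 - \<nu> * p t ^ 3 / s t ^ 3
      \<le> - (\<kappa> / (2 * sr\<^sup>2)) * N t + (7 * c * (1 + \<epsilon>1) * sr + \<kappa> / sr) * (c / \<beta> * (8 * \<nu> / sr))\<^sup>2 * (L t)\<^sup>2"
    using main by linarith
qed

lemma integral_U_square_le:
  assumes t: "t \<ge> 0"
  shows "s t * integral {0..1} (\<lambda>y. (U t y)\<^sup>2) \<le> sr\<^sup>2 * N t"
proof -
  have st: "0 < s t" "s t < sr" using s_pos s_less t by auto
  let ?E = "integral {0..1} (\<lambda>y. (Uy t y)\<^sup>2)"
  have "integral {0..1} (\<lambda>y. (U t y)\<^sup>2) \<le> integral {0..1} (\<lambda>y::real. ?E)"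
  proof (rule integral_le)
    fix y :: real assume y: "y \<in> {0..1}"
    have "(U t y - U t 1)\<^sup>2 \<le> ?E"
      by (rule square_increment_le[OF dU_y[OF t] cont_slice(2)[OF t]]) (use y in auto)
    then show "(U t y)\<^sup>2 \<le> ?E" using U1[OF t] by simp
  qed (intro integrable_continuous_interval continuous_intros cont_slice t)+
  then have "s t * integral {0..1} (\<lambda>y. (U t y)\<^sup>2) \<le> s t * ?E" using st by simp
  also have "\<dots> = (s t)\<^sup>2 * N t" using st by (simp add: N_def power2_eq_square)
  also have "\<dots> \<le> sr\<^sup>2 * N t" using st N_nonneg[OF t] by (intro mult_right_mono power_mono) auto
  finally show ?thesis .
qed

end

section \<open>Decay with uniform constants\<close>

text \<open>Every constant, including the waiting time \<open>\<tau>\<close>, is fixed from the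
  parameters before a solution is chosen; this gives the uniformity of \<open>D\<close> and
  \<open>b\<close>.\<close>

lemma normalized_stefan_decay:
  fixes \<alpha> \<beta> \<epsilon>1 \<epsilon>2 c sr \<kappa> \<nu> :: real
  assumes params: "\<alpha> > 0" "\<beta> > 0" "\<epsilon>1 > -1" "\<epsilon>2 > -1" "c > 0" "sr > 0"
    and \<kappa>: "\<kappa> = \<alpha> * (1 + \<epsilon>1)" and \<nu>: "\<nu> = \<beta> * (1 + \<epsilon>2)" and small: "6 * c * sr\<^sup>2 \<le> \<alpha>"
  shows "\<exists>D>0. \<exists>b>0. \<forall>s U Uy Uyy Ut. normalized_stefan \<alpha> \<beta> \<epsilon>1 \<epsilon>2 c sr s U Uy Uyy Ut \<kappa> \<nu> \<longrightarrow> (\<forall>t\<ge>0.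
    s t * integral {0..1} (\<lambda>y. (U t y)\<^sup>2) + integral {0..1} (\<lambda>y. (Uy t y)\<^sup>2) / s t + (s t - sr)\<^sup>2
    \<le> D * (integral {0..1} (\<lambda>y. (Uy 0 y)\<^sup>2) / s 0 + (s 0 - sr)\<^sup>2) * exp (- b * t))"
proof -
  have \<kappa>0: "\<kappa> > 0" and \<nu>0: "\<nu> > 0" using params by (auto simp: \<kappa> \<nu>)
  note nz = params \<kappa>0 \<nu>0
  define C0 where "C0 = 2 * \<alpha> * sr ^ 3 / \<beta>"
  define C1 where "C1 = 2 * \<kappa> * sr\<^sup>2 * c / \<beta>"
  define k where "k = \<kappa> / sr"
  define C where "C = 1 / (\<kappa> * sr) + c * sr / (6 * \<kappa> * \<alpha>) + 1 / (2 * \<nu>) + c * sr\<^sup>2 / (24 * \<alpha> * \<nu>)"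
  define q where "q = c / \<beta>"
  define A where "A = C * (1 + C1 / k + 2 * C0 / k\<^sup>2)"
  define m where "m = q * sr / (4 * sqrt A)"
  define \<tau> where "\<tau> = 1 + sqrt A * sr / m"
  define k1 where "k1 = c * (1 + \<epsilon>2) / (2 * sr)"
  define \<eta>1 where "\<eta>1 = \<kappa> / (2 * sr\<^sup>2)"
  define k2 where "k2 = 8 * \<nu> / sr"
  define C2 where "C2 = (7 * c * (1 + \<epsilon>1) * sr + \<kappa> / sr) * (c / \<beta> * (8 * \<nu> / sr))\<^sup>2"
  define \<eta> where "\<eta> = k1 * sr / 2"
  define b where "b = min \<eta>1 \<eta>"
  define K where "K = C2 / \<eta>"
  have pos: "C0 > 0" "C1 > 0" "k > 0" "q > 0" "k1 > 0" "\<eta>1 > 0" "k2 > 0"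
    using nz by (auto simp: C0_def C1_def k_def q_def k1_def \<eta>1_def k2_def)
  have C: "C > 0" unfolding C_def using nz by (intro add_pos_pos divide_pos_pos mult_pos_pos) auto
  have "7 * c * (1 + \<epsilon>1) * sr > 0" "\<kappa> / sr > 0" "c / \<beta> * (8 * \<nu> / sr) > 0" using nz by auto
  then have C2: "C2 > 0" unfolding C2_def by (rule mult_pos_pos[OF add_pos_pos zero_less_power])
  have pos2: "\<eta> > 0" "b > 0" "K > 0" using pos C2 nz by (auto simp: \<eta>_def b_def K_def)
  have A: "A > 0" unfolding A_def using pos C by (intro mult_pos_pos add_pos_pos) auto
  then have m: "m > 0" unfolding m_def using pos nz by simp
  then have \<tau>: "\<tau> \<ge> 0" unfolding \<tau>_def using A nz by simp
  \<comment> \<open>\<open>D1\<close> passes from \<open>N + K * L\<^sup>2\<close> to the norm at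
    time \<open>t\<close>, \<open>D2\<close> from the initial norm back to this functional.\<close>
  define D1 where "D1 = sr\<^sup>2 + 1 + k2\<^sup>2 / K"
  define D2 where "D2 = 1 + K * (sr / \<nu>)\<^sup>2"
  define D where "D = D1 * D2 * exp ((\<eta> + b) * \<tau>)"
  have D1: "D1 > 0" unfolding D1_def using pos2 nz by (intro add_pos_nonneg) auto
  have D2: "D2 > 0" unfolding D2_def using pos2 nz by (intro add_pos_nonneg) auto
  have D: "D > 0" unfolding D_def using D1 D2 by simp
  show ?thesis
  proof (rule exI[of _ D], rule conjI[OF D], rule exI[of _ b], rule conjI[OF pos2(2)], intro allI impI)
    fix s U Uy Uyy Ut and t :: real
    assume "normalized_stefan \<alpha> \<beta> \<epsilon>1 \<epsilon>2 c sr s U Uy Uyy Ut \<kappa> \<nu>" and t: "t \<ge> 0"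
    then interpret normalized_stefan \<alpha> \<beta> \<epsilon>1 \<epsilon>2 c sr s U Uy Uyy Ut \<kappa> \<nu> by simp
    have G0: "0 \<le> G t" if "t \<ge> 0" for t
      using order_trans[OF mult_nonneg_nonneg G_bounds(1)[OF that]] M_ge0[OF that] nz by simp
    have half: "sr / 2 \<le> s \<tau>"
      by (rule front_reaches_half[where s = s and G = G and Y = Y, OF nz(6) pos(1,2,3) C pos(4) s_pos s_mono cont_functionals(1) _ G0 _
          cont_functionals(3) _ Y_pos _ A_def m_def \<tau>_def])
        (use dG_le G_bounds(3) dY Y_upper in \<open>auto simp: C0_def C1_def k_def q_def C_def\<close>)
    have decay: "N t + K * (L t)\<^sup>2 \<le> (N 0 + K * (L 0)\<^sup>2) * exp ((\<eta> + b) * \<tau>) * exp (- b * t)"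
      by (rule coupled_decay[where s = s and L = L and N = N, OF nz(6) pos(5,6) C2 \<tau> s_pos s_mono half cont_functionals(2,4) _ _ L_bounds(1) N_nonneg
          \<eta>_def b_def K_def t])
        (use dL_le[OF _ small] dN_le[OF _ small] in \<open>auto simp: k1_def \<eta>1_def C2_def\<close>)
    have "(s t - sr)\<^sup>2 \<le> (k2 * L t)\<^sup>2"
      using L_bounds(2)[OF t] s_less[OF t] by (subst power2_commute) (intro power_mono, auto simp: k2_def)
    also have "\<dots> = k2\<^sup>2 / K * (K * (L t)\<^sup>2)" using pos2 by (simp add: power_mult_distrib)
    finally have "s t * integral {0..1} (\<lambda>y. (U t y)\<^sup>2) + N t + (s t - sr)\<^sup>2
        \<le> sr\<^sup>2 * N t + N t + k2\<^sup>2 / K * (K * (L t)\<^sup>2)"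
      using integral_U_square_le[OF t] by linarith
    also have "\<dots> = (sr\<^sup>2 + 1) * N t + k2\<^sup>2 / K * (K * (L t)\<^sup>2)" by (simp add: algebra_simps)
    also have "\<dots> \<le> D1 * N t + D1 * (K * (L t)\<^sup>2)"
    proof (rule add_mono)
      have "0 \<le> k2\<^sup>2 / K" using pos2 by simp
      then have "sr\<^sup>2 + 1 \<le> D1" "k2\<^sup>2 / K \<le> D1" by (auto simp: D1_def)
      moreover have "0 \<le> K * (L t)\<^sup>2" using pos2 by simp
      ultimately show "(sr\<^sup>2 + 1) * N t \<le> D1 * N t" "k2\<^sup>2 / K * (K * (L t)\<^sup>2) \<le> D1 * (K * (L t)\<^sup>2)"
        using N_nonneg[OF t] mult_right_mono by blast+
    qed
    also have "\<dots> = D1 * (N t + K * (L t)\<^sup>2)" by (simp add: algebra_simps)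
    also have "\<dots> \<le> D1 * ((N 0 + K * (L 0)\<^sup>2) * exp ((\<eta> + b) * \<tau>) * exp (- b * t))"
      using decay D1 by (intro mult_left_mono) auto
    also have "\<dots> \<le> D1 * ((D2 * (N 0 + (s 0 - sr)\<^sup>2)) * exp ((\<eta> + b) * \<tau>) * exp (- b * t))"
    proof (intro mult_left_mono mult_right_mono)
      have "(L 0)\<^sup>2 \<le> (sr / \<nu> * (sr - s 0))\<^sup>2"
        using L_bounds(1,3)[of 0] by (intro power_mono) auto
      also have "\<dots> = (sr / \<nu>)\<^sup>2 * (s 0 - sr)\<^sup>2" by (simp only: power_mult_distrib power2_commute[of sr "s 0"])
      finally have "K * (L 0)\<^sup>2 \<le> K * ((sr / \<nu>)\<^sup>2 * (s 0 - sr)\<^sup>2)" using pos2 by simp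
      also have "\<dots> = (D2 - 1) * (s 0 - sr)\<^sup>2" by (simp add: D2_def)
      also have "\<dots> \<le> D2 * (s 0 - sr)\<^sup>2" by (intro mult_right_mono) auto
      finally have "K * (L 0)\<^sup>2 \<le> D2 * (s 0 - sr)\<^sup>2" .
      moreover have "1 * N 0 \<le> D2 * N 0"
        using N_nonneg[of 0] pos2 by (intro mult_right_mono) (auto simp: D2_def)
      ultimately show "N 0 + K * (L 0)\<^sup>2 \<le> D2 * (N 0 + (s 0 - sr)\<^sup>2)" by (simp add: algebra_simps)
    qed (use D1 in auto)
    also have "\<dots> = D * (N 0 + (s 0 - sr)\<^sup>2) * exp (- b * t)" by (simp add: D_def)
    finally show "s t * integral {0..1} (\<lambda>y. (U t y)\<^sup>2) + integral {0..1} (\<lambda>y. (Uy t y)\<^sup>2) / s t + (s t - sr)\<^sup>2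
      \<le> D * (integral {0..1} (\<lambda>y. (Uy 0 y)\<^sup>2) / s 0 + (s 0 - sr)\<^sup>2) * exp (- b * t)"
      by (simp add: N_def)
  qed
qed

section \<open>Transformation of classical solutions\<close>

lemma mean_value_between:
  fixes f f' :: "real \<Rightarrow> real"
  assumes "a \<noteq> b" "\<And>x. x \<in> closed_segment a b \<Longrightarrow> (f has_real_derivative f' x) (at x)"
  shows "\<exists>x\<in>closed_segment a b. f b - f a = (b - a) * f' x"
proof (cases "a < b")
  case True
  have "\<exists>z>a. z < b \<and> f b - f a = (b - a) * f' z"
    by (rule MVT2[OF True]) (use assms True in \<open>auto simp: closed_segment_eq_real_ivl\<close>)
  then obtain z where "a < z" "z < b" "f b - f a = (b - a) * f' z" by blast
  then show ?thesis using True by (intro bexI[of _ z]) (auto simp: closed_segment_eq_real_ivl)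
next
  case False
  then have ba: "b < a" using assms by simp
  have "\<exists>z>b. z < a \<and> f a - f b = (a - b) * f' z"
    by (rule MVT2[OF ba]) (use assms ba in \<open>auto simp: closed_segment_eq_real_ivl\<close>)
  then obtain z where "b < z" "z < a" "f a - f b = (a - b) * f' z" by blast
  then show ?thesis using ba by (intro bexI[of _ z]) (auto simp: closed_segment_eq_real_ivl algebra_simps)
qed

lemma integral_rescale:
  fixes f :: "real \<Rightarrow> real"
  assumes "l > 0" "continuous_on {0..l} f"
  shows "integral {0..l} f = l * integral {0..1} (\<lambda>y. f (l * y))"
proof -
  have "(f has_integral integral {0..l} f) {0..l}"
    by (intro integrable_integral integrable_continuous_interval assms)
  from has_integral_stretch_real[OF this, of l] assms(1)
  have "((\<lambda>y. f (l * y)) has_integral (1 / l) * integral {0..l} f) ((\<lambda>x. x / l) ` {0..l})" by simp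
  moreover have "(\<lambda>x. x / l) ` {0..l} = {0..1}"
    using image_divide_atLeastAtMost[of l 0 l] assms(1) by simp
  ultimately have "integral {0..1} (\<lambda>y. f (l * y)) = (1 / l) * integral {0..l} f"
    by (simp add: integral_unique)
  then show ?thesis using assms(1) by simp
qed

lemma derivative_along_ray:
  fixes T Tx Tt :: "real \<Rightarrow> real \<Rightarrow> real" and s :: "real \<Rightarrow> real"
  assumes t: "t > 0" and y: "0 < y" "y < 1" and s_pos: "\<And>t. t \<ge> 0 \<Longrightarrow> s t > 0"
    and ds: "(s has_real_derivative s') (at t)"
    and dx: "((\<lambda>x. T x t) has_real_derivative Tx (s t * y) t) (at (s t * y))"
    and dt: "\<And>u x. u > 0 \<Longrightarrow> 0 < x \<Longrightarrow> x < s u \<Longrightarrow> ((\<lambda>\<tau>. T x \<tau>) has_real_derivative Tt x u) (at u)"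
    and cont: "continuous_on (liquid_domain s \<inter> {(x, t). t > 0}) (\<lambda>(x, t). Tt x t)"
  shows "((\<lambda>\<tau>. T (s \<tau> * y) \<tau>) has_real_derivative Tt (s t * y) t + y * s' * Tx (s t * y) t) (at t)"
proof -
  have st: "s t > 0" using s_pos t by simp
  have "((\<lambda>\<tau>. T (s \<tau> * y) t) has_real_derivative Tx (s t * y) t * (s' * y)) (at t)"
    by (rule DERIV_chain2[where f = "\<lambda>x. T x t" and g = "\<lambda>\<tau>. s \<tau> * y", OF dx]) (auto intro!: derivative_eq_intros ds)
  moreover have "((\<lambda>\<tau>. T (s \<tau> * y) \<tau> - T (s \<tau> * y) t) has_real_derivative Tt (s t * y) t) (at t)"
    unfolding has_field_derivative_iff LIM_def
  proof (intro allI impI)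
    fix \<epsilon> :: real assume \<epsilon>: "\<epsilon> > 0"
    let ?Q = "liquid_domain s \<inter> {(x, t). t > 0}"
    have "(s t * y, t) \<in> ?Q" using t y st by (auto simp: liquid_domain_def mult_le_cancel_left1)
    then obtain \<delta> where \<delta>: "\<delta> > 0" "\<And>q. q \<in> ?Q \<Longrightarrow> dist q (s t * y, t) < \<delta> \<Longrightarrow>
        dist ((\<lambda>(x, t). Tt x t) q) (Tt (s t * y) t) < \<epsilon>"
      using cont \<epsilon> unfolding continuous_on_iff by force
    \<comment> \<open>Half the gap to the front keeps \<open>s \<tau> * y\<close> inside the liquid
      at all times between \<open>t\<close> and \<open>\<tau>\<close>; \<open>\<delta> / 2\<close>
      leaves the other half for the time distance.\<close>
    define \<gamma> where "\<gamma> = min (\<delta> / 2) (s t * (1 - y) / 2)"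
    have \<gamma>: "\<gamma> > 0" using \<delta> st y by (simp add: \<gamma>_def)
    have "isCont s t" using ds by (rule DERIV_isCont)
    then obtain \<eta>1 where \<eta>1: "\<eta>1 > 0" "\<And>u. dist u t < \<eta>1 \<Longrightarrow> dist (s u) (s t) < \<gamma>"
      using \<gamma> unfolding continuous_at_eps_delta by blast
    define \<eta> where "\<eta> = min \<eta>1 (min (\<delta> / 2) t)"
    have \<eta>: "\<eta> > 0" using \<eta>1 \<delta> t by (simp add: \<eta>_def)
    have "dist ((T (s \<tau> * y) \<tau> - T (s \<tau> * y) t - (T (s t * y) t - T (s t * y) t)) / (\<tau> - t)) (Tt (s t * y) t) < \<epsilon>"
      if \<tau>: "\<tau> \<noteq> t" "dist \<tau> t < \<eta>" for \<tau>
    proof -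
      have near: "dist (s u) (s t) < \<gamma>" "u > 0" "dist u t < \<delta> / 2" if "u \<in> closed_segment t \<tau>" for u
      proof -
        have "dist u t \<le> dist \<tau> t" using that by (auto simp: closed_segment_eq_real_ivl dist_real_def split: if_splits)
        then have "dist u t < \<eta>" using \<tau> by simp
        then show "dist u t < \<delta> / 2" "dist (s u) (s t) < \<gamma>" "u > 0"
          using \<eta>1(2)[of u] by (auto simp: \<eta>_def dist_real_def)
      qed
      have "\<tau> \<in> closed_segment t \<tau>" by simp
      note near\<tau> = near[OF this]
      have "s \<tau> > 0" using s_pos near\<tau>(2) by simp
      have "\<bar>s \<tau> * y - s t * y\<bar> = \<bar>s \<tau> - s t\<bar> * y" using y by (simp add: abs_mult flip: left_diff_distrib)
      also have "\<dots> \<le> \<bar>s \<tau> - s t\<bar> * 1" using y by (intro mult_left_mono) auto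
      finally have x_near: "\<bar>s \<tau> * y - s t * y\<bar> < \<gamma>" using near\<tau>(1) by (simp add: dist_real_def)
      have below: "s \<tau> * y < s u" if "u \<in> closed_segment t \<tau>" for u
      proof -
        have \<gamma>_le: "\<gamma> \<le> s t * (1 - y) / 2" by (simp add: \<gamma>_def)
        with x_near have "s \<tau> * y < s t * y + s t * (1 - y) / 2" by linarith
        moreover have "s t - s t * (1 - y) / 2 < s u" 
          using near(1)[OF that] \<gamma>_le unfolding dist_real_def by linarith
        moreover have "s t * y + s t * (1 - y) / 2 = s t - s t * (1 - y) / 2" by (simp add: field_simps)
        ultimately show ?thesis by linarith
      qed
      have "\<exists>u\<in>closed_segment t \<tau>. T (s \<tau> * y) \<tau> - T (s \<tau> * y) t = (\<tau> - t) * Tt (s \<tau> * y) u"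
        by (rule mean_value_between) (use \<tau> near below y \<open>s \<tau> > 0\<close> dt in auto)
      then obtain u where u: "u \<in> closed_segment t \<tau>" "T (s \<tau> * y) \<tau> - T (s \<tau> * y) t = (\<tau> - t) * Tt (s \<tau> * y) u" by blast
      have "(s \<tau> * y, u) \<in> ?Q"
        using near(2)[OF u(1)] below[OF u(1)] y \<open>s \<tau> > 0\<close> by (auto simp: liquid_domain_def)
      moreover have "dist (s \<tau> * y, u) (s t * y, t) < \<delta>"
      proof -
        have "dist (s \<tau> * y, u) (s t * y, t) \<le> \<bar>dist (s \<tau> * y) (s t * y)\<bar> + \<bar>dist u t\<bar>"
          unfolding dist_Pair_Pair by (rule sqrt_sum_squares_le_sum_abs)
        moreover have "\<gamma> \<le> \<delta> / 2" by (simp add: \<gamma>_def)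
        ultimately show ?thesis using x_near near(3)[OF u(1)] by (simp add: dist_real_def)
      qed
      ultimately have "dist (Tt (s \<tau> * y) u) (Tt (s t * y) t) < \<epsilon>" using \<delta>(2) by fastforce
      then show ?thesis using u(2) \<tau>(1) by simp
    qed
    with \<eta> show "\<exists>d>0. \<forall>x. x \<noteq> t \<and> dist x t < d \<longrightarrow>
        dist ((T (s x * y) x - T (s x * y) t - (T (s t * y) t - T (s t * y) t)) / (x - t)) (Tt (s t * y) t) < \<epsilon>" by blast
  qed
  ultimately have "((\<lambda>\<tau>. (T (s \<tau> * y) \<tau> - T (s \<tau> * y) t) + T (s \<tau> * y) t) has_real_derivative
      Tt (s t * y) t + Tx (s t * y) t * (s' * y)) (at t)" by (intro DERIV_add)
  then show ?thesis by (simp add: mult_ac)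
qed

lemma normalize_solution:
  fixes \<alpha> \<beta> Tm \<epsilon>1 \<epsilon>2 c sr s0 :: real and T0 s :: "real \<Rightarrow> real" and T :: "real \<Rightarrow> real \<Rightarrow> real"
  assumes params: "\<alpha> > 0" "\<beta> > 0" "\<epsilon>1 > -1" "\<epsilon>2 > -1" "\<epsilon>1 \<ge> \<epsilon>2" "c > 0" "sr > 0"
    and \<kappa>: "\<kappa> = \<alpha> * (1 + \<epsilon>1)" and \<nu>: "\<nu> = \<beta> * (1 + \<epsilon>2)"
    and adm: "admissible_data \<alpha> \<beta> Tm sr T0 s0"
    and sol: "closed_loop_solution \<alpha> \<beta> Tm \<epsilon>1 \<epsilon>2 c sr T0 s0 T s"
  obtains U Uy Uyy Ut where "normalized_stefan \<alpha> \<beta> \<epsilon>1 \<epsilon>2 c sr s U Uy Uyy Ut \<kappa> \<nu>"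
    and "\<And>t. t \<ge> 0 \<Longrightarrow> stability_norm Tm sr T s t =
      s t * integral {0..1} (\<lambda>y. (U t y)\<^sup>2) + integral {0..1} (\<lambda>y. (Uy t y)\<^sup>2) / s t + (s t - sr)\<^sup>2"
proof -
  from sol obtain Tx Txx Tt where positive: "\<forall>t\<ge>0. s t > 0"
    and cT: "continuous_on (liquid_domain s) (\<lambda>(x, t). T x t)"
    and cTx: "continuous_on (liquid_domain s) (\<lambda>(x, t). Tx x t)"
    and cTxx: "continuous_on (liquid_domain s \<inter> {(x, t). t > 0}) (\<lambda>(x, t). Txx x t)"
    and cTt: "continuous_on (liquid_domain s \<inter> {(x, t). t > 0}) (\<lambda>(x, t). Tt x t)"
    and laws: "\<forall>t\<ge>0. \<forall>x\<in>{0..s t}. ((\<lambda>y. T y t) has_real_derivative Tx x t) (at x within {0..s t})"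
      "\<forall>t>0. \<forall>x\<in>{0..s t}. ((\<lambda>y. Tx y t) has_real_derivative Txx x t) (at x within {0..s t})"
      "\<forall>t>0. \<forall>x\<in>{0<..<s t}. ((\<lambda>\<tau>. T x \<tau>) has_real_derivative Tt x t) (at t)"
      "\<forall>t>0. \<forall>x\<in>{0..s t}. Tt x t = \<alpha> * (1 + \<epsilon>1) * Txx x t"
      "\<forall>t\<ge>0. (s has_real_derivative - \<beta> * (1 + \<epsilon>2) * Tx (s t) t) (at t within {0..})"
      "\<forall>t\<ge>0. T 0 t = Tm + control \<alpha> \<beta> Tm c sr T s t"
      "\<forall>t\<ge>0. T (s t) t = Tm" "\<forall>x\<in>{0..s0}. T x 0 = T0 x" and s0: "s 0 = s0"
    unfolding closed_loop_solution_def by (elim conjE exE) (rule that)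
  note s_pos = positive[rule_format] and dTx = laws(1)[rule_format] and dTxx = laws(2)[rule_format]
    and dTt = laws(3)[rule_format] and heat = laws(4)[rule_format] and ds = laws(5)[rule_format]
    and T0 = laws(6)[rule_format] and Ts = laws(7)[rule_format] and init = laws(8)[rule_format]
  define U where "U t y = T (s t * y) t - Tm" for t y
  define Uy where "Uy t y = s t * Tx (s t * y) t" for t y
  define Uyy where "Uyy t y = (s t)\<^sup>2 * Txx (s t * y) t" for t y
  \<comment> \<open>The derivative along the ray of constant \<open>y\<close>, with
    \<open>- \<nu> * Tx (s t) t\<close> as the front velocity.\<close>
  define Ut where "Ut t y = Tt (s t * y) t + y * (- \<nu> * Tx (s t) t) * Tx (s t * y) t" for t y
  have ray: "s t * y \<in> {0..s t}" if "t \<ge> 0" "y \<in> {0..1}" for t y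
    using s_pos[OF that(1)] that(2) by (simp add: mult_le_cancel_left1)
  have cs: "continuous_on {0..} s"
    using ds by (auto simp: continuous_on_eq_continuous_within intro: DERIV_continuous)
  have c\<phi>: "continuous_on ({0..} \<times> {0..1}) (\<lambda>q. (s (fst q) * snd q, fst q))"
    by (intro continuous_intros continuous_on_compose2[OF cs]) auto
  have pull: "continuous_on ({0..} \<times> {0..1}) (\<lambda>(t, y). f (s t * y) t)"
    if "continuous_on (liquid_domain s) (\<lambda>(x, t). f x t)" for f :: "real \<Rightarrow> real \<Rightarrow> real"
    using continuous_on_compose2[OF that c\<phi>] ray by (force simp: case_prod_unfold liquid_domain_def)
  have pull0: "continuous_on ({0<..} \<times> {0..1}) (\<lambda>(t, y). f (s t * y) t)"
    if "continuous_on (liquid_domain s \<inter> {(x, t). t > 0}) (\<lambda>(x, t). f x t)" for f :: "real \<Rightarrow> real \<Rightarrow> real"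
  proof -
    have "continuous_on ({0<..} \<times> {0..1}) (\<lambda>q. (s (fst q) * snd q, fst q))"
      by (rule continuous_on_subset[OF c\<phi>]) auto
    from continuous_on_compose2[OF that this] show ?thesis
      using ray by (force simp: case_prod_unfold liquid_domain_def)
  qed
  have cs2: "continuous_on ({0..} \<times> {0..1::real}) (\<lambda>q. s (fst q))"
    by (intro continuous_on_compose2[OF cs] continuous_intros) auto
  have cs20: "continuous_on ({0<..} \<times> {0..1::real}) (\<lambda>q. s (fst q))"
    by (rule continuous_on_subset[OF cs2]) auto
  have cU: "continuous_on ({0..} \<times> {0..1}) (\<lambda>(t, y). U t y)"
    using pull[OF cT] by (auto simp: U_def case_prod_unfold intro!: continuous_intros)
  have cUy: "continuous_on ({0..} \<times> {0..1}) (\<lambda>(t, y). Uy t y)"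
    using pull[OF cTx] cs2 by (auto simp: Uy_def case_prod_unfold intro!: continuous_intros)
  have cUyy: "continuous_on ({0<..} \<times> {0..1}) (\<lambda>(t, y). Uyy t y)"
    using pull0[OF cTxx] cs20 by (auto simp: Uyy_def case_prod_unfold intro!: continuous_intros)
  have cTxs: "continuous_on ({0..} \<times> {0..1::real}) (\<lambda>q. Tx (s (fst q)) (fst q))"
  proof -
    have "continuous_on {0..} (\<lambda>t. Tx (s t * 1) t)" by (rule continuous_on_slice2[OF pull[OF cTx]]) simp
    then show ?thesis by (intro continuous_on_compose2[of "{0..}" "\<lambda>t. Tx (s t) t" _ fst] continuous_intros) auto
  qed
  have cUt: "continuous_on ({0<..} \<times> {0..1}) (\<lambda>(t, y). Ut t y)"
  proof -
    have "continuous_on ({0<..} \<times> {0..1::real}) (\<lambda>q. Tx (s (fst q)) (fst q))"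
      "continuous_on ({0<..} \<times> {0..1}) (\<lambda>(t, y). Tx (s t * y) t)"
      by (rule continuous_on_subset[OF cTxs] continuous_on_subset[OF pull[OF cTx]]; auto)+
    then show ?thesis using pull0[OF cTt]
      by (auto simp: Ut_def case_prod_unfold intro!: continuous_intros)
  qed
  have chain: "((\<lambda>y. f (s t * y)) has_real_derivative s t * d) (at y within {0..1})"
    if "t \<ge> 0" "y \<in> {0..1}" "(f has_real_derivative d) (at (s t * y) within {0..s t})"
    for f :: "real \<Rightarrow> real" and d t y
  proof -
    have "(f has_real_derivative d) (at (s t * y) within (\<lambda>y. s t * y) ` {0..1})"
      by (rule DERIV_subset[OF that(3)]) (use ray that in auto)
    moreover have "((\<lambda>y. s t * y) has_real_derivative s t) (at y within {0..1})"
      by (auto intro!: derivative_eq_intros)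
    ultimately have "(f \<circ> (\<lambda>y. s t * y) has_real_derivative d * s t) (at y within {0..1})"
      by (rule DERIV_image_chain)
    then show ?thesis by (simp add: o_def mult.commute)
  qed
  have dUy: "(U t has_real_derivative Uy t y) (at y within {0..1})" if "t \<ge> 0" "y \<in> {0..1}" for t y
  proof -
    have "((\<lambda>y. T (s t * y) t) has_real_derivative s t * Tx (s t * y) t) (at y within {0..1})"
      by (rule chain[OF that dTx]) (use that ray in auto)
    then show ?thesis unfolding U_def[abs_def] Uy_def by (auto intro!: derivative_eq_intros)
  qed
  have dUyy: "(Uy t has_real_derivative Uyy t y) (at y within {0..1})" if "t > 0" "y \<in> {0..1}" for t y
  proof -
    have "((\<lambda>y. Tx (s t * y) t) has_real_derivative s t * Txx (s t * y) t) (at y within {0..1})"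
      by (rule chain[OF _ that(2) dTxx]) (use that ray in auto)
    from DERIV_cmult[OF this, of "s t"] show ?thesis
      unfolding Uy_def[abs_def] Uyy_def by (simp add: power2_eq_square mult.assoc)
  qed
  have ds0: "(s has_real_derivative - \<nu> * Tx (s t) t) (at t)" if "t > 0" for t
  proof -
    have "(s has_real_derivative - \<beta> * (1 + \<epsilon>2) * Tx (s t) t) (at t within {0<..})"
      by (rule DERIV_subset[OF ds]) (use that in auto)
    then show ?thesis using that by (simp add: at_within_open[of t "{0<..}"] \<nu>)
  qed
  \<comment> \<open>The chain rule along rays works only for interior \<open>y\<close>; continuity
    of \<open>Ut\<close> carries it to \<open>0\<close> and \<open>1\<close>.\<close>
  have dUt: "((\<lambda>\<tau>. U \<tau> y) has_real_derivative Ut t y) (at t)" if "t > 0" "y \<in> {0..1}" for t y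
  proof (rule time_derivative_up_to_boundary[OF _ cUt _ that])
    show "continuous_on {0..1} (U t)" if "t > 0" for t
      by (rule continuous_on_slice[OF cU]) (use that in simp)
    fix t y :: real assume t: "t > 0" and y: "0 < y" "y < 1"
    have st: "s t > 0" using s_pos t by simp
    have in_dom: "0 < s t * y" "s t * y < s t" using st y by auto
    have dx: "((\<lambda>x. T x t) has_real_derivative Tx (s t * y) t) (at (s t * y))"
      using dTx[of t "s t * y"] t y in_dom at_within_Icc_at[of 0 "s t * y" "s t"] by simp
    have "((\<lambda>\<tau>. T (s \<tau> * y) \<tau>) has_real_derivative
        Tt (s t * y) t + y * (- \<nu> * Tx (s t) t) * Tx (s t * y) t) (at t)"
      by (rule derivative_along_ray[where T = T and Tx = Tx and Tt = Tt, OF t y s_pos ds0[OF t] dx _ cTt])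
        (use dTt in auto)
    then show "((\<lambda>\<tau>. U \<tau> y) has_real_derivative Ut t y) (at t)"
      unfolding U_def Ut_def by (auto intro!: derivative_eq_intros)
  qed
  have slice: "continuous_on {0..s t} (\<lambda>x. T x t)" "continuous_on {0..s t} (\<lambda>x. Tx x t)" if "t \<ge> 0" for t
  proof -
    have c: "continuous_on {0..s t} (\<lambda>x. (x, t))" by (intro continuous_intros)
    show "continuous_on {0..s t} (\<lambda>x. T x t)" "continuous_on {0..s t} (\<lambda>x. Tx x t)"
      using continuous_on_compose2[OF cT c] continuous_on_compose2[OF cTx c] that
      by (auto simp: liquid_domain_def image_subset_iff)
  qed
  have moment: "integral {0..s t} (\<lambda>x. x * (T x t - Tm)) = (s t)\<^sup>2 * integral {0..1} (\<lambda>y. y * U t y)"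
    if "t \<ge> 0" for t
  proof -
    have "integral {0..s t} (\<lambda>x. x * (T x t - Tm)) = s t * integral {0..1} (\<lambda>y. s t * y * (T (s t * y) t - Tm))"
      by (rule integral_rescale[OF s_pos[OF that]]) (intro continuous_intros slice that)
    also have "integral {0..1} (\<lambda>y. s t * y * (T (s t * y) t - Tm)) = s t * integral {0..1} (\<lambda>y. y * U t y)"
      by (simp add: U_def mult.assoc)
    finally show ?thesis by (simp add: power2_eq_square)
  qed
  have norm: "stability_norm Tm sr T s t =
      s t * integral {0..1} (\<lambda>y. (U t y)\<^sup>2) + integral {0..1} (\<lambda>y. (Uy t y)\<^sup>2) / s t + (s t - sr)\<^sup>2"
    if "t \<ge> 0" for t
  proof -
    have "L2_sq (s t) (\<lambda>x. T x t - Tm) = s t * integral {0..1} (\<lambda>y. (U t y)\<^sup>2)"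
      unfolding L2_sq_def U_def
      by (rule integral_rescale[OF s_pos[OF that]]) (intro continuous_intros slice that)
    moreover have "L2_sq (s t) (deriv (\<lambda>x. T x t - Tm)) = integral {0..1} (\<lambda>y. (Uy t y)\<^sup>2) / s t"
    proof -
      \<comment> \<open>The two-sided \<open>deriv\<close> agrees with \<open>Tx\<close> except
        possibly at the end points, a null set.\<close>
      have "L2_sq (s t) (deriv (\<lambda>x. T x t - Tm)) = integral {0..s t} (\<lambda>x. (Tx x t)\<^sup>2)"
        unfolding L2_sq_def
      proof (rule integral_spike[of "{0, s t}"])
        fix x assume x: "x \<in> {0..s t} - {0, s t}"
        then have "((\<lambda>x. T x t) has_real_derivative Tx x t) (at x)"
          using dTx[of t x] that at_within_Icc_at[of 0 x "s t"] by simp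
        then have "((\<lambda>x. T x t - Tm) has_real_derivative Tx x t) (at x)"
          by (auto intro!: derivative_eq_intros)
        then show "(Tx x t)\<^sup>2 = (deriv (\<lambda>x. T x t - Tm) x)\<^sup>2" by (simp add: DERIV_imp_deriv)
      qed simp
      also have "\<dots> = s t * integral {0..1} (\<lambda>y. (Tx (s t * y) t)\<^sup>2)"
        by (rule integral_rescale[OF s_pos[OF that]]) (intro continuous_intros slice that)
      also have "\<dots> = integral {0..1} (\<lambda>y. (Uy t y)\<^sup>2) / s t"
      proof -
        have "integral {0..1} (\<lambda>y. (Uy t y)\<^sup>2) = (s t)\<^sup>2 * integral {0..1} (\<lambda>y. (Tx (s t * y) t)\<^sup>2)"
          by (simp add: Uy_def power_mult_distrib)
        then show ?thesis using s_pos[OF that] by (simp add: power2_eq_square[of "s t"])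
      qed
      finally show ?thesis .
    qed
    ultimately show ?thesis by (simp add: stability_norm_def H1_sq_def)
  qed
  from adm have adm': "s0 > 0" "\<And>x. x \<in> {0..s0} \<Longrightarrow> 0 \<le> T0 x - Tm"
    "sr > sqrt (s0\<^sup>2 + 2 * \<beta> / \<alpha> * integral {0..s0} (\<lambda>x. x * (T0 x - Tm)))"
    unfolding admissible_data_def by auto
  have U_init: "U 0 y \<ge> 0" if "y \<in> {0..1}" for y
    using adm'(2)[of "s 0 * y"] init[of "s 0 * y"] ray[of 0 y] that s0 by (simp add: U_def)
  have setpoint: "(s 0)\<^sup>2 / (2 * \<beta>) + (s 0)\<^sup>2 * integral {0..1} (\<lambda>y. y * U 0 y) / \<alpha> < sr\<^sup>2 / (2 * \<beta>)"
  proof -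
    have "integral {0..s0} (\<lambda>x. x * (T0 x - Tm)) = integral {0..s 0} (\<lambda>x. x * (T x 0 - Tm))"
      unfolding s0 by (rule integral_cong) (use init in simp)
    also have "\<dots> = (s 0)\<^sup>2 * integral {0..1} (\<lambda>y. y * U 0 y)" by (rule moment) simp
    finally have I: "integral {0..s0} (\<lambda>x. x * (T0 x - Tm)) = (s 0)\<^sup>2 * integral {0..1} (\<lambda>y. y * U 0 y)" .
    have "sqrt ((s 0)\<^sup>2 + 2 * \<beta> / \<alpha> * ((s 0)\<^sup>2 * integral {0..1} (\<lambda>y. y * U 0 y))) < sr"
      using adm'(3) by (simp only: I s0)
    then have "(s 0)\<^sup>2 + 2 * \<beta> / \<alpha> * ((s 0)\<^sup>2 * integral {0..1} (\<lambda>y. y * U 0 y)) < sr\<^sup>2"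
      using real_le_rsqrt by (meson linorder_not_le)
    then have "((s 0)\<^sup>2 + 2 * \<beta> / \<alpha> * ((s 0)\<^sup>2 * integral {0..1} (\<lambda>y. y * U 0 y))) / (2 * \<beta>) < sr\<^sup>2 / (2 * \<beta>)"
      using params by (intro divide_strict_right_mono) auto
    then show ?thesis using params by (simp add: add_divide_distrib)
  qed
  have "normalized_stefan \<alpha> \<beta> \<epsilon>1 \<epsilon>2 c sr s U Uy Uyy Ut \<kappa> \<nu>"
  proof
    fix t :: real
    show "(s has_real_derivative - \<nu> * Uy t 1 / s t) (at t)" if "t > 0"
      using ds0[OF that] s_pos[of t] that by (simp add: Uy_def)
    show "U t 1 = 0" if "t \<ge> 0" using Ts[OF that] by (simp add: U_def)
    show "U t 0 = - c * ((s t)\<^sup>2 * integral {0..1} (\<lambda>y. y * U t y) / \<alpha> + s t * (s t - sr) / \<beta>)" if "t \<ge> 0"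
      using T0[OF that] unfolding U_def[of t 0] control_def moment[OF that] by simp
    fix y :: real
    show "Ut t y = (\<kappa> * Uyy t y - \<nu> * Uy t 1 * (y * Uy t y)) / (s t)\<^sup>2" if "t > 0" "y \<in> {0..1}"
      unfolding Ut_def heat[OF that(1) ray[OF less_imp_le[OF that(1)] that(2)]] Uyy_def Uy_def \<kappa>
      using s_pos[of t] that by (simp add: field_simps power2_eq_square)
  qed (use params \<kappa> \<nu> s_pos cs cU cUy cUyy cUt dUy dUyy dUt U_init setpoint in auto)
  then show ?thesis using norm that by blast
qed

section \<open>Gain threshold and return to the physical variables\<close>

theorem theorem6:
  fixes \<alpha> \<beta> Tm \<epsilon>1 \<epsilon>2 sr :: real
  assumes "\<alpha> > 0" and "\<beta> > 0"
    and "\<epsilon>1 > -1" and "\<epsilon>2 > -1"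
    and "\<epsilon>1 \<ge> \<epsilon>2"
  shows "\<exists>cs>0. \<forall>c. 0 < c \<and> c < cs \<longrightarrow> closed_loop_exp_stable \<alpha> \<beta> Tm \<epsilon>1 \<epsilon>2 c sr"
proof (cases "sr > 0")
  case False
  \<comment> \<open>For a nonpositive setpoint there are no admissible data, and stability holds
    vacuously.\<close>
  have "\<not> admissible_data \<alpha> \<beta> Tm sr T0 s0" for T0 s0
  proof
    assume adm: "admissible_data \<alpha> \<beta> Tm sr T0 s0"
    then have T0: "\<And>x. x \<in> {0..s0} \<Longrightarrow> 0 \<le> x * (T0 x - Tm)" unfolding admissible_data_def by auto
    have "integral {0..s0} (\<lambda>x. x * (T0 x - Tm)) \<ge> 0"
    \<comment> \<open>\<open>T0\<close> is an arbitrary function here; if the integrand is not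
      integrable, the integral has the default value \<open>0\<close>.\<close>
    proof (cases "(\<lambda>x. x * (T0 x - Tm)) integrable_on {0..s0}")
      case True
      then show ?thesis by (rule integral_nonneg) (rule T0)
    qed (simp add: not_integrable_integral)
    then have "sqrt (s0\<^sup>2 + 2 * \<beta> / \<alpha> * integral {0..s0} (\<lambda>x. x * (T0 x - Tm))) \<ge> 0"
      using assms by simp
    with adm False show False unfolding admissible_data_def by linarith
  qed
  then have "closed_loop_exp_stable \<alpha> \<beta> Tm \<epsilon>1 \<epsilon>2 c sr" for c
    unfolding closed_loop_exp_stable_def using zero_less_one by blast
  then show ?thesis using zero_less_one by blast
next
  case True
  \<comment> \<open>The threshold is the condition \<open>6 * c * sr\<^sup>2 \<le> \<alpha>\<close>
    solved for \<open>c\<close>.\<close>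
  have "closed_loop_exp_stable \<alpha> \<beta> Tm \<epsilon>1 \<epsilon>2 c sr" if c: "0 < c" "c < \<alpha> / (6 * sr\<^sup>2)" for c
  proof -
    have "6 * c * sr\<^sup>2 \<le> \<alpha>" using c True by (simp add: field_simps)
    from normalized_stefan_decay[OF assms(1-4) c(1) True refl refl this]
    obtain D b where Db: "D > 0" "b > 0" and decay: "\<And>s U Uy Uyy Ut t.
        normalized_stefan \<alpha> \<beta> \<epsilon>1 \<epsilon>2 c sr s U Uy Uyy Ut (\<alpha> * (1 + \<epsilon>1)) (\<beta> * (1 + \<epsilon>2)) \<Longrightarrow> t \<ge> 0 \<Longrightarrow>
        s t * integral {0..1} (\<lambda>y. (U t y)\<^sup>2) + integral {0..1} (\<lambda>y. (Uy t y)\<^sup>2) / s t + (s t - sr)\<^sup>2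
        \<le> D * (integral {0..1} (\<lambda>y. (Uy 0 y)\<^sup>2) / s 0 + (s 0 - sr)\<^sup>2) * exp (- b * t)"
      by blast
    have "stability_norm Tm sr T s t \<le> D * stability_norm Tm sr T s 0 * exp (- b * t)"
      if adm: "admissible_data \<alpha> \<beta> Tm sr T0 s0"
        and sol: "closed_loop_solution \<alpha> \<beta> Tm \<epsilon>1 \<epsilon>2 c sr T0 s0 T s" and t: "t \<ge> 0" for T0 s0 T s t
    proof -
      obtain U Uy Uyy Ut where ns: "normalized_stefan \<alpha> \<beta> \<epsilon>1 \<epsilon>2 c sr s U Uy Uyy Ut (\<alpha> * (1 + \<epsilon>1)) (\<beta> * (1 + \<epsilon>2))"
        and norm: "\<And>t. t \<ge> 0 \<Longrightarrow> stability_norm Tm sr T s t =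
          s t * integral {0..1} (\<lambda>y. (U t y)\<^sup>2) + integral {0..1} (\<lambda>y. (Uy t y)\<^sup>2) / s t + (s t - sr)\<^sup>2"
        using normalize_solution[OF assms c(1) True refl refl adm sol] by blast
      interpret normalized_stefan \<alpha> \<beta> \<epsilon>1 \<epsilon>2 c sr s U Uy Uyy Ut "\<alpha> * (1 + \<epsilon>1)" "\<beta> * (1 + \<epsilon>2)" by (rule ns)
      \<comment> \<open>The decay estimate has only the gradient and the front on its right side;
        adding the nonnegative \<open>L2\<close> part gives the full initial norm.\<close>
      have "integral {0..1} (\<lambda>y. (U 0 y)\<^sup>2) \<ge> 0"
        by (intro integral_nonneg integrable_continuous_interval continuous_intros cont_slice) auto
      then have "integral {0..1} (\<lambda>y. (Uy 0 y)\<^sup>2) / s 0 + (s 0 - sr)\<^sup>2 \<le> stability_norm Tm sr T s 0"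
        using norm[of 0] s_pos[of 0] by simp
      then have "D * (integral {0..1} (\<lambda>y. (Uy 0 y)\<^sup>2) / s 0 + (s 0 - sr)\<^sup>2) * exp (- b * t)
          \<le> D * stability_norm Tm sr T s 0 * exp (- b * t)"
        using Db by (intro mult_right_mono mult_left_mono) auto
      with decay[OF ns t] norm[OF t] show ?thesis by linarith
    qed
    then show ?thesis unfolding closed_loop_exp_stable_def using Db by blast
  qed
  moreover have "\<alpha> / (6 * sr\<^sup>2) > 0" using assms True by simp
  ultimately show ?thesis by blast
qed

end
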